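(* Let $d \geq 2$, $p_1, p_2 \in (0,1]$ and $\mathbf{y} \in \mathbb{Z}^d \setminus \{\mathbf{0}\}$, and fix any tie-breaking mechanism. There exist $M \in \mathbb{N}$, depending only on $p_1 \wedge p_2 = \min\{p_1,p_2\}$ and $d$, and $\theta \in (0,1)$, depending on $M$ (and not on the law of the initial configuration below), such that: (a) for the two-type competing frog model with any deterministic initial configuration satisfying $\eta(\mathbf{x}) \geq M$ for all $\mathbf{x} \in \mathbb{Z}^d \setminus \{\mathbf{0}, \mathbf{y}\}$, one has $\mathbb{P}_{\mathbf{0}, \mathbf{y}}(G_1 \cap G_2) > 0$; and (b) for the two-type competing frog model with any initial configuration $\{\eta(\mathbf{x}) : \mathbf{x} \in \mathbb{Z}^d\}$ of i.i.d. non-negative integer valued random variables satisfying $\mathbb{P}(\eta(\mathbf{0}) \geq M) \geq \theta$, coexistence occurs with positive probability under $\mathbb{P}_{\mathbf{0}, \mathbf{y}}$, i.e. $\mathbb{P}_{\mathbf{0}, \mathbf{y}}(G_1 \cap G_2) > 0$.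
   Context: Two-type competing frog model on $\mathbb{Z}^d$ with laziness parameters $p_1,p_2\in(0,1]$: at time $0$ there is exactly one particle at $\mathbf{0}$, which is active and of type $1$, and exactly one particle at a site $\mathbf{y}\neq\mathbf{0}$, which is active and of type $2$; every other site $\mathbf{x}\in\mathbb{Z}^d\setminus\{\mathbf{0},\mathbf{y}\}$ contains $\eta(\mathbf{x})\in\{0,1,2,\dots\}$ dormant particles. If the initial configuration is random, it is independent of all the random movements described next. Time is discrete. At each time step, independently of everything else, each active particle of type $i$ ($i=1,2$) stays at its present site with probability $1-p_i$, and with probability $p_i$ moves to a uniformly chosen one of the $2d$ nearest neighbours of its present site. Dormant particles do not move. When a site $\mathbf{x}\notin\{\mathbf{0},\mathbf{y}\}$ is first hit by active particle(s) (at time $n$, say), all dormant particles there become active at time $n$ (and make their first step between times $n$ and $n+1$). If all the particles arriving at $\mathbf{x}$ at that time have the same type $i$, the newly activated particles get type $i$. If particles of both types arrive at that time, the types of the newly activated particles are decided by a tie-breaking mechanism, i.e. an arbitrary fixed rule (deterministic, or using the history of the process up to time $n$ and additional independent randomness) assigning to each newly activated particle one of the types that arrived. Once active, a particle stays active and never changes type. $\mathbb{P}_{\mathbf{0},\mathbf{y}}$ denotes the law of this process (including the randomness of $\eta(\mathbf{x})$, $\mathbf{x}\notin\{\mathbf{0},\mathbf{y}\}$, when the configuration is random). $N_n(i)$ is the set of active type $i$ particles at time $n$, $|N_n(i)|$ is its cardinality, and $G_i := \{|N_n(i)| \to \infty \text{ as } n \to \infty\}$ for $i=1,2$. Coexistence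 is the event $G_1\cap G_2$. *)

theory Defs
  imports "HOL-Probability.Probability"
begin

type_synonym 'd site = "int ^ 'd"

datatype frog_type = Type1 | Type2

text \<open>
  A particle is named by the site at which it starts and a number: the particles initially at a
  dormant site \<open>x\<close> are \<open>(x, k)\<close> with \<open>k < \<eta> x\<close>, and the two particles that are active at time 0
  are \<open>(0, 0)\<close> and \<open>(y, 0)\<close>.
\<close>

type_synonym 'd particle = "'d site \<times> nat"

text \<open>
  A configuration gives the current site and type of every active particle; the value \<^term>\<open>None\<close>
  stands for a dormant particle, and also for a name that no particle bears.
\<close>

type_synonym 'd config = "'d particle \<Rightarrow> ('d site \<times> frog_type) option"

definition unit_vectors :: "('d::finite) site set" where
  "unit_vectors = (\<lambda>(i, s). axis i s) ` (UNIV \<times> {1, -1})"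

lemma finite_unit_vectors: "finite unit_vectors"
  by (simp add: unit_vectors_def)

lemma card_unit_vectors: "card (unit_vectors :: ('d::finite) site set) = 2 * CARD('d)"
proof -
  have "inj_on (\<lambda>(i::'d, s::int). axis i s) (UNIV \<times> {1, -1})"
    by (auto simp: inj_on_def axis_eq_axis)
  then show ?thesis
    by (simp add: unit_vectors_def card_image card_cartesian_product)
qed

definition lazy_step :: "real \<Rightarrow> ('d::finite) site pmf" where
  "lazy_step p =
     bind_pmf (bernoulli_pmf p) (\<lambda>move. if move then pmf_of_set unit_vectors else return_pmf 0)"

text \<open>
  The displacement \<open>\<xi> (q, i, n)\<close> is the one that particle \<open>q\<close> makes between the times \<open>n\<close> and
  \<open>n + 1\<close> if it is then active and of type \<open>i\<close>. All these displacements are independent, and those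
  belonging to inactive particles or to the wrong type are never looked at.
\<close>

type_synonym 'd displacements = "'d particle \<times> frog_type \<times> nat \<Rightarrow> 'd site"

definition laziness :: "real \<Rightarrow> real \<Rightarrow> frog_type \<Rightarrow> real" where
  "laziness p1 p2 i = (case i of Type1 \<Rightarrow> p1 | Type2 \<Rightarrow> p2)"

definition displacement_law :: "real \<Rightarrow> real \<Rightarrow> ('d::finite) displacements measure" where
  "displacement_law p1 p2 = PiM UNIV (\<lambda>(q, i, n). measure_pmf (lazy_step (laziness p1 p2 i)))"

text \<open>
  A tie-breaking rule \<open>tie n \<eta> h u x k\<close> decides the type of particle \<open>(x, k)\<close> when it is activated
  at time \<open>n\<close> by particles of both types. It may use the initial numbers \<open>\<eta>\<close> of dormant particles,
  the history \<open>h\<close> of the process up to time \<open>n\<close> and additional independent randomness \<open>u\<close>. Here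
  \<open>h m\<close> for \<open>m < n\<close> is the configuration at time \<open>m\<close>, and \<open>h n\<close> is the one after the particles have
  moved to their positions at time \<open>n\<close> but before any activation at that time.

  The additional randomness comes from an arbitrary probability space \<open>R\<close>, with any sigma-algebra,
  carried by a set of reals. That is no restriction on the law of the process: the decisions form a
  countable family of two-valued random variables, which can be generated from one uniform
  variable, and in the same way \<open>u\<close> can encode fresh randomness for every decision.
\<close>

type_synonym 'd tie_rule =
  "nat \<Rightarrow> ('d site \<Rightarrow> nat) \<Rightarrow> (nat \<Rightarrow> 'd config) \<Rightarrow> real \<Rightarrow> 'd site \<Rightarrow> nat \<Rightarrow> frog_type"

definition tie_breaking_mechanism :: "real measure \<Rightarrow> ('d::finite) tie_rule \<Rightarrow> bool" where
  "tie_breaking_mechanism R tie \<longleftrightarrow>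
     prob_space R \<and>
     (\<forall>n x k. (\<lambda>(\<eta>, h, u). tie n \<eta> h u x k)
        \<in> PiM UNIV (\<lambda>_. count_space UNIV) \<Otimes>\<^sub>M
          (PiM UNIV (\<lambda>_. PiM UNIV (\<lambda>_. count_space UNIV)) \<Otimes>\<^sub>M R)
          \<rightarrow>\<^sub>M count_space UNIV)"

definition initial_config :: "('d::finite) site \<Rightarrow> 'd config" where
  "initial_config y =
     (\<lambda>q. if q = (0, 0) then Some (0, Type1) else if q = (y, 0) then Some (y, Type2) else None)"

definition move :: "('d particle \<Rightarrow> frog_type \<Rightarrow> 'd site) \<Rightarrow> ('d::finite) config \<Rightarrow> 'd config" where
  "move \<delta> c = (\<lambda>q. map_option (\<lambda>(z, i). (z + \<delta> q i, i)) (c q))"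

definition types_at :: "('d::finite) config \<Rightarrow> 'd site \<Rightarrow> frog_type set" where
  "types_at c x = {i. \<exists>q. c q = Some (x, i)}"

text \<open>
  Activation looks at all active particles present at \<open>x\<close>, not only at those that have just
  arrived. This is the same thing as long as \<open>x\<close> still holds dormant particles, for then no active
  particle has been at \<open>x\<close> before.
\<close>

definition activate ::
    "('d::finite) site \<Rightarrow> ('d site \<Rightarrow> nat) \<Rightarrow> ('d site \<Rightarrow> nat \<Rightarrow> frog_type) \<Rightarrow> 'd config \<Rightarrow> 'd config"
where
  "activate y \<eta> tb c = (\<lambda>(x, k). case c (x, k) of
       Some s \<Rightarrow> Some s
     | None \<Rightarrow>
         if x \<notin> {0, y} \<and> k < \<eta> x \<and> types_at c x \<noteq> {}
         then Some (x, if types_at c x = {Type1} then Type1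
                       else if types_at c x = {Type2} then Type2
                       else tb x k)
         else None)"

text \<open>
  The entries \<open>0, \<dots>, n\<close> of \<open>history y tie \<eta> \<xi> u n\<close> are the configurations at these times; the
  later entries are mere padding.
\<close>

primrec history ::
    "('d::finite) site \<Rightarrow> 'd tie_rule \<Rightarrow> ('d site \<Rightarrow> nat) \<Rightarrow> 'd displacements \<Rightarrow> real
      \<Rightarrow> nat \<Rightarrow> nat \<Rightarrow> 'd config"
where
  "history y tie \<eta> \<xi> u 0 = (\<lambda>_. initial_config y)"
| "history y tie \<eta> \<xi> u (Suc n) =
     (let h = history y tie \<eta> \<xi> u n;
          c = move (\<lambda>q i. \<xi> (q, i, n)) (h n)
      in h(Suc n := activate y \<eta> (tie (Suc n) \<eta> (h(Suc n := c)) u) c))"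

definition frogs ::
    "('d::finite) site \<Rightarrow> 'd tie_rule \<Rightarrow> ('d site \<Rightarrow> nat) \<Rightarrow> 'd displacements \<Rightarrow> real
      \<Rightarrow> nat \<Rightarrow> 'd config"
where
  "frogs y tie \<eta> \<xi> u n = history y tie \<eta> \<xi> u n n"

definition active_particles :: "frog_type \<Rightarrow> ('d::finite) config \<Rightarrow> 'd particle set" where
  "active_particles i c = {q. \<exists>z. c q = Some (z, i)}"

text \<open>
  The sets of active particles are always finite, so that \<^const>\<open>card\<close> is their true cardinality.
\<close>

lemma finite_active_particles: "finite (active_particles i (frogs y tie \<eta> \<xi> u n))"
proof -
  have "finite (dom (frogs y tie \<eta> \<xi> u n))"
  proof (induction n)
    case 0
    have "dom (initial_config y) \<subseteq> {(0, 0), (y, 0)}"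
      by (auto simp: initial_config_def split: if_splits)
    then show ?case by (simp add: frogs_def finite_subset)
  next
    case (Suc n)
    define c where "c = move (\<lambda>q i. \<xi> (q, i, n)) (frogs y tie \<eta> \<xi> u n)"
    define X where "X = (\<lambda>q. fst (the (c q))) ` dom c"
    have "dom c = dom (frogs y tie \<eta> \<xi> u n)"
      by (auto simp: c_def move_def dom_def)
    with Suc have fin: "finite (dom c)" by simp
    obtain tb where step: "frogs y tie \<eta> \<xi> u (Suc n) = activate y \<eta> tb c"
      by (simp add: frogs_def Let_def c_def)
    have X: "x \<in> X" if "i \<in> types_at c x" for x i
      using that by (force simp: types_at_def X_def image_iff dom_def)
    have "dom (activate y \<eta> tb c) \<subseteq> dom c \<union> (SIGMA x:X. {..<\<eta> x})"
      using X by (auto simp: activate_def split: option.splits if_splits)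
    moreover have "finite (dom c \<union> (SIGMA x:X. {..<\<eta> x}))"
      using fin by (auto simp: X_def)
    ultimately show ?case using step by (simp add: finite_subset)
  qed
  then show ?thesis
    by (rule finite_subset[rotated]) (auto simp: active_particles_def)
qed

definition survives :: "frog_type \<Rightarrow> (nat \<Rightarrow> ('d::finite) config) \<Rightarrow> bool" where
  "survives i c \<longleftrightarrow> filterlim (\<lambda>n. card (active_particles i (c n))) at_top sequentially"

text \<open>
  The canonical space carries the initial numbers \<open>\<eta>\<close> of dormant particles with law \<open>Q\<close>, the
  displacements and the additional randomness for the tie-breaking, these three being independent.
  The entries of \<open>\<eta>\<close> at \<open>0\<close> and \<open>y\<close> play no role.
\<close>

definition frog_space ::
    "real \<Rightarrow> real \<Rightarrow> real measure \<Rightarrow> ('d site \<Rightarrow> nat) measure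
      \<Rightarrow> (('d site \<Rightarrow> nat) \<times> ('d::finite) displacements \<times> real) measure"
where
  "frog_space p1 p2 R Q = Q \<Otimes>\<^sub>M (displacement_law p1 p2 \<Otimes>\<^sub>M R)"

definition coexistence_prob ::
    "real \<Rightarrow> real \<Rightarrow> ('d::finite) site \<Rightarrow> real measure \<Rightarrow> 'd tie_rule \<Rightarrow> ('d site \<Rightarrow> nat) measure \<Rightarrow> real"
where
  "coexistence_prob p1 p2 y R tie Q =
     \<P>((\<eta>, \<xi>, u) in frog_space p1 p2 R Q.
        survives Type1 (frogs y tie \<eta> \<xi> u) \<and> survives Type2 (frogs y tie \<eta> \<xi> u))"

definition deterministic_law :: "(('d::finite) site \<Rightarrow> nat) \<Rightarrow> ('d site \<Rightarrow> nat) measure" where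
  "deterministic_law \<eta> = return (PiM UNIV (\<lambda>_. count_space UNIV)) \<eta>"

definition iid_law :: "nat pmf \<Rightarrow> (('d::finite) site \<Rightarrow> nat) measure" where
  "iid_law \<mu> = PiM UNIV (\<lambda>_. measure_pmf \<mu>)"

end

(*
  Each type i is given a quadrant based at its start and pointing away from the other start. A site
  of the quadrant at distance n from the start of type i is farther than n from the other start, so
  if type i gets there at time n, the maximal speed, then no tie occurs and all its dormant particles
  become type i. Call such a site closed if it holds fewer than M particles or if none of M particles
  jumps at once in one of the two directions of the quadrant. Type i survives if there is an infinite
  oriented path of sites that are not closed. Sites are closed independently and with a probability
  that is small, uniformly in i, so a Peierls bound over dual paths gives that for either type the
  path is missing with probability at most 1/18 times that of the two prescribed first jumps.
*)

theory Submission
  imports Defs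
begin

section \<open>Oriented paths and dual paths\<close>

text \<open>North and west steps stay weakly on the upper left of any infinite north-east path from
  the origin, and a south-east step can leave that side only from a site of the path itself. Hence
  only south-east steps must be paid for by a closed site, and a dual path from the origin to (1,
  -1) is what rules out an open path. Its net displacement forces more than a third of its steps to
  be south-east, so that exponential decay can beat the number of paths. Each start holds a single
  particle, and no choice of \<open>M\<close> makes its first jump likely. The first jumps of both
  types are therefore prescribed, and the failure of each type is estimated inside that event; any
  factor below 1/2 per type would do. The first jumps use time 0 and all other jumps later times, so
  this factor splits off by independence. The tie-breaking rule, which may look at the entire past,
  never enters an estimate: survival is forced by occupation numbers and displacements
  alone.\<close>

definition south_east :: "int \<times> int" where "south_east = (1, -1)"

text \<open>Paths are listed backwards: the head is the endpoint and the last entry is the origin.\<close>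

fun dual_path :: "(int \<times> int) list \<Rightarrow> bool" where
  "dual_path [] = False"
| "dual_path [z] = (z = 0)"
| "dual_path (z' # z # zs) \<longleftrightarrow> z' - z \<in> {(0, 1), (-1, 0), south_east} \<and> dual_path (z # zs)"

fun crossed :: "(int \<times> int) list \<Rightarrow> (int \<times> int) set" where
  "crossed (z' # z # zs) = (if z' - z = south_east then insert z else id) (crossed (z # zs))"
| "crossed _ = {}"

lemma crossed_subset: "crossed (z # zs) \<subseteq> set zs"
  by (induction "z # zs" arbitrary: z zs rule: crossed.induct) auto

lemma finite_crossed: "finite (crossed zs)"
  by (induction zs rule: crossed.induct) auto

text \<open>With s south-east, v north and w west steps the endpoint is (s - w, v - s) and the
  length is s + v + w, which combine to 3 s. Distinctness of the sites makes the set
  \<open>crossed\<close> count the south-east steps without loss.\<close>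

lemma card_crossed:
  assumes "dual_path (z # zs)" "distinct (z # zs)"
  shows "3 * int (card (crossed (z # zs))) = int (length zs) + fst z - snd z"
  using assms
proof (induction zs arbitrary: z)
  case Nil
  then show ?case by simp
next
  case (Cons x zs)
  have *: "3 * int (card (crossed (x # zs))) = int (length zs) + fst x - snd x"
    using Cons by simp
  have x: "x \<notin> crossed (x # zs)"
    using Cons.prems crossed_subset[of x zs] by auto
  from Cons.prems have "z - x \<in> {(0, 1), (-1, 0), south_east}" by simp
  then consider "z - x = (0, 1)" | "z - x = (-1, 0)" | "z - x = south_east" by blast
  then show ?case
    using * x by cases (auto simp: south_east_def finite_crossed prod_eq_iff)
qed

lemma dual_paths_finite_card:
  "finite {zs. dual_path zs \<and> length zs = Suc n} \<and>
   card {zs. dual_path zs \<and> length zs = Suc n} \<le> 3 ^ n"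
proof (induction n)
  case 0
  have "{zs. dual_path zs \<and> length zs = Suc 0} = {[0]}"
  proof (intro equalityI subsetI)
    fix zs assume "zs \<in> {zs. dual_path zs \<and> length zs = Suc 0}"
    then show "zs \<in> {[0]}" by (cases zs) simp_all
  qed simp
  then show ?case by simp
next
  case (Suc n)
  define P where "P = {zs. dual_path zs \<and> length zs = Suc n}"
  define D where "D = {(0, 1), (-1, 0), south_east}"
  have D: "finite D" "card D = 3" by (auto simp: D_def south_east_def)
  have sub: "{zs. dual_path zs \<and> length zs = Suc (Suc n)} \<subseteq> (\<lambda>(d, zs). (hd zs + d) # zs) ` (D \<times> P)"
  proof
    fix zs assume "zs \<in> {zs. dual_path zs \<and> length zs = Suc (Suc n)}"
    then obtain z' z ys where zs: "zs = z' # z # ys" "dual_path zs" "length ys = n"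
      by (auto simp: length_Suc_conv)
    then have "(z' - z, z # ys) \<in> D \<times> P" "zs = (\<lambda>(d, zs). (hd zs + d) # zs) (z' - z, z # ys)"
      by (auto simp: D_def P_def)
    then show "zs \<in> (\<lambda>(d, zs). (hd zs + d) # zs) ` (D \<times> P)" by blast
  qed
  have fin: "finite (D \<times> P)" and card: "card (D \<times> P) \<le> 3 * 3 ^ n"
    using Suc D by (auto simp: P_def card_cartesian_product)
  show ?case
    using finite_subset[OF sub] card_mono[OF _ sub] card_image_le[OF fin, of "\<lambda>(d, zs). (hd zs + d) # zs"] fin card
    by (auto intro: order_trans)
qed

lemma dual_path_drop: "dual_path (xs @ z # zs) \<Longrightarrow> dual_path (z # zs)"
proof (induction xs)
  case (Cons x xs)
  then show ?case by (cases xs) auto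
qed simp

lemma crossed_drop: "crossed (z # zs) \<subseteq> crossed (xs @ z # zs)"
proof (induction xs)
  case (Cons x xs)
  then show ?case by (cases xs) auto
qed simp

text \<open>Paths are required to be self-avoiding so that the number of distinct closed sites on a
  path is fixed by its length and endpoint.\<close>

definition dual_cluster :: "(int \<times> int) set \<Rightarrow> (int \<times> int) set" where
  "dual_cluster C = {z. \<exists>zs. dual_path (z # zs) \<and> distinct (z # zs) \<and> crossed (z # zs) \<subseteq> C}"

lemma dual_cluster_origin: "0 \<in> dual_cluster C"
  by (auto simp: dual_cluster_def intro!: exI[of _ "[]"])

text \<open>If the new site already lies on the path, the path is cut back to its visit there, which
  keeps it self-avoiding and adds no crossing; otherwise it is prolonged.\<close>

lemma dual_cluster_step:
  assumes "z \<in> dual_cluster C" "d \<in> {(0, 1), (-1, 0), south_east}" "d = south_east \<Longrightarrow> z \<in> C"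
  shows "z + d \<in> dual_cluster C"
proof -
  obtain zs where zs: "dual_path (z # zs)" "distinct (z # zs)" "crossed (z # zs) \<subseteq> C"
    using assms(1) by (auto simp: dual_cluster_def)
  show ?thesis
  proof (cases "z + d \<in> set (z # zs)")
    case True
    then obtain xs ys where eq: "z # zs = xs @ (z + d) # ys" by (meson split_list)
    then show ?thesis
      using zs crossed_drop[of "z + d" ys xs] dual_path_drop[of xs "z + d" ys]
      by (auto simp: dual_cluster_def intro!: exI[of _ ys])
  next
    case False
    have "dual_path ((z + d) # z # zs)" "distinct ((z + d) # z # zs)" "crossed ((z + d) # z # zs) \<subseteq> C"
      using zs assms(2,3) False by auto
    then show ?thesis unfolding dual_cluster_def by blast
  qed
qed

text \<open>
  Follow the right boundary of the dual cluster from the origin: the current site \<open>z\<close> is in the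
  cluster and \<open>z + (1, -1)\<close> is not, so that \<open>z\<close> is not in \<open>C\<close>; the walk turns east whenever that
  keeps it in the cluster.
\<close>

lemma infinite_path_if_no_dual_path:
  assumes "south_east \<notin> dual_cluster C"
  obtains w where "w 0 = 0" "\<And>n. w n \<notin> C" "\<And>n. w (Suc n) - w n \<in> {(1, 0), (0, 1)}"
proof -
  define inv where "inv z \<longleftrightarrow> z \<in> dual_cluster C \<and> z + south_east \<notin> dual_cluster C" for z
  have step: "\<exists>z'. inv z' \<and> z' - z \<in> {(1, 0), (0, 1)}" if "inv z" for z
  proof (cases "z + (1, 0) \<in> dual_cluster C")
    case True
    have "z + (1, 0) + south_east \<notin> dual_cluster C"
    proof
      assume "z + (1, 0) + south_east \<in> dual_cluster C"
      from dual_cluster_step[OF this, of "(-1, 0)"] have "z + south_east \<in> dual_cluster C"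
        by (auto simp: south_east_def algebra_simps)
      with that show False by (simp add: inv_def)
    qed
    with True show ?thesis by (intro exI[of _ "z + (1, 0)"]) (auto simp: inv_def)
  next
    case False
    have "z + (0, 1) \<in> dual_cluster C"
      using dual_cluster_step[of z C "(0, 1)"] that by (auto simp: inv_def south_east_def)
    moreover have "z + (0, 1) + south_east = z + (1, 0)"
      by (cases z) (simp add: south_east_def)
    ultimately have "inv (z + (0, 1))"
      using False by (simp only: inv_def simp_thms)
    then show ?thesis by (intro exI[of _ "z + (0, 1)"]) auto
  qed
  define w where "w = rec_nat 0 (\<lambda>_ z. SOME z'. inv z' \<and> z' - z \<in> {(1, 0), (0, 1)})"
  have w_Suc: "inv (w n) \<Longrightarrow> inv (w (Suc n)) \<and> w (Suc n) - w n \<in> {(1, 0), (0, 1)}" for n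
    using someI_ex[OF step[of "w n"]] by (simp only: w_def old.nat.simps)
  have inv_w: "inv (w n)" for n
  proof (induction n)
    case 0
    then show ?case using assms dual_cluster_origin by (simp add: inv_def w_def)
  next
    case (Suc n)
    then show ?case using w_Suc by blast
  qed
  have w: "w 0 = 0" "\<And>n. inv (w n)" "\<And>n. w (Suc n) - w n \<in> {(1, 0), (0, 1)}"
    using inv_w w_Suc by (simp only: w_def old.nat.simps, blast, blast)
  have "w n \<notin> C" for n
    using w(2)[of n] dual_cluster_step[of "w n" C south_east] by (auto simp: inv_def)
  with w show thesis using that by blast
qed

section \<open>Speed of the frogs\<close>

definition l1_norm :: "int ^ 'd \<Rightarrow> int" where
  "l1_norm x = (\<Sum>i\<in>UNIV. \<bar>x $ i\<bar>)"

lemma l1_norm_zero [simp]: "l1_norm 0 = 0"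
  by (simp add: l1_norm_def)

lemma l1_norm_triangle: "l1_norm (x + y) \<le> l1_norm x + l1_norm y"
  unfolding l1_norm_def by (auto simp: sum.distrib[symmetric] intro!: sum_mono)

lemma l1_norm_axis [simp]: "l1_norm (axis a s) = \<bar>s\<bar>"
proof -
  have "(\<Sum>i\<in>UNIV. \<bar>axis a s $ i\<bar>) = (\<Sum>i\<in>UNIV. if i = a then \<bar>s\<bar> else 0)"
    by (intro sum.cong) (auto simp: axis_def)
  then show ?thesis by (simp add: l1_norm_def)
qed

lemma l1_norm_ge_two_coordinates:
  assumes "a \<noteq> b"
  shows "\<bar>x $ a\<bar> + \<bar>x $ b\<bar> \<le> l1_norm x"
proof -
  have "(\<Sum>i\<in>{a, b}. \<bar>x $ i\<bar>) \<le> (\<Sum>i\<in>UNIV. \<bar>x $ i\<bar>)"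
    by (intro sum_mono2) auto
  then show ?thesis using assms by (simp add: l1_norm_def)
qed

lemma l1_norm_unit_vectors: "e \<in> unit_vectors \<Longrightarrow> l1_norm e = 1"
  by (auto simp: unit_vectors_def)

section \<open>Movement, activation and the range reached by a given time\<close>

fun other_type :: "frog_type \<Rightarrow> frog_type" where
  "other_type Type1 = Type2"
| "other_type Type2 = Type1"

definition start :: "'d site \<Rightarrow> frog_type \<Rightarrow> ('d::finite) site" where
  "start y i = (case i of Type1 \<Rightarrow> 0 | Type2 \<Rightarrow> y)"

lemma start_simps [simp]: "start y Type1 = 0" "start y Type2 = y"
  by (simp_all add: start_def)

text \<open>With argument \<open>n\<close> this is the state of time \<open>n + 1\<close> between
  movement and activation, when the arrivals are visible but nobody has been woken.\<close>

definition after_move ::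
    "('d::finite) site \<Rightarrow> 'd tie_rule \<Rightarrow> ('d site \<Rightarrow> nat) \<Rightarrow> 'd displacements \<Rightarrow> real
      \<Rightarrow> nat \<Rightarrow> 'd config"
where
  "after_move y tie \<eta> \<xi> u n = move (\<lambda>q i. \<xi> (q, i, n)) (frogs y tie \<eta> \<xi> u n)"

lemma frogs_0: "frogs y tie \<eta> \<xi> u 0 = initial_config y"
  by (simp add: frogs_def)

text \<open>The tie decisions are hidden in an arbitrary \<open>tb\<close>, so whatever is derived
  from this step holds for every tie-breaking rule.\<close>

lemma frogs_Suc:
  obtains tb where "frogs y tie \<eta> \<xi> u (Suc n) = activate y \<eta> tb (after_move y tie \<eta> \<xi> u n)"
  by (simp add: frogs_def after_move_def Let_def)

lemma after_move_Some_iff: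
  "after_move y tie \<eta> \<xi> u n q = Some (z, i) \<longleftrightarrow>
     (\<exists>x. frogs y tie \<eta> \<xi> u n q = Some (x, i) \<and> z = x + \<xi> (q, i, n))"
  by (auto simp: after_move_def move_def)

lemma activate_Some: "c q = Some s \<Longrightarrow> activate y \<eta> tb c q = Some s"
  by (cases q) (simp add: activate_def)

lemma UNIV_frog_type: "UNIV = {Type1, Type2}"
  using frog_type.exhaust by auto

text \<open>The rule \<open>tb\<close> is consulted only when both types are present, so whatever it
  returns is the type of some particle at \<open>x\<close>.\<close>

lemma activate_None:
  assumes "c (x, k) = None" "activate y \<eta> tb c (x, k) = Some (z, i)"
  shows "z = x" "x \<notin> {0, y}" "i \<in> types_at c x"
proof -
  have "types_at c x \<subseteq> {Type1, Type2}"
    using UNIV_frog_type by blast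
  then have "types_at c x \<in> {{}, {Type1}, {Type2}, UNIV}"
    unfolding UNIV_frog_type by (simp add: subset_insert_iff, blast)
  then show "z = x" "x \<notin> {0, y}" "i \<in> types_at c x"
    using assms by (auto simp: activate_def split: if_splits)
qed

lemma frogs_move:
  "frogs y tie \<eta> \<xi> u n q = Some (x, i) \<Longrightarrow> frogs y tie \<eta> \<xi> u (Suc n) q = Some (x + \<xi> (q, i, n), i)"
  by (rule frogs_Suc[of y tie \<eta> \<xi> u n]) (auto intro!: activate_Some simp: after_move_Some_iff)

lemma frogs_active_mono:
  assumes "frogs y tie \<eta> \<xi> u m q = Some (x, i)" "m \<le> n"
  shows "\<exists>z. frogs y tie \<eta> \<xi> u n q = Some (z, i)"
  using assms(2,1) by (induction rule: dec_induct) (auto dest: frogs_move)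

definition unit_speed :: "('d::finite) displacements \<Rightarrow> bool" where
  "unit_speed \<xi> \<longleftrightarrow> (\<forall>r. l1_norm (\<xi> r) \<le> 1)"

lemma after_move_distance:
  assumes "unit_speed \<xi>" "after_move y tie \<eta> \<xi> u n q = Some (z, i)"
    and "\<And>q z i. frogs y tie \<eta> \<xi> u n q = Some (z, i) \<Longrightarrow> l1_norm (z - start y i) \<le> int n"
  shows "l1_norm (z - start y i) \<le> int (Suc n)"
proof -
  obtain x where x: "frogs y tie \<eta> \<xi> u n q = Some (x, i)" "z = x + \<xi> (q, i, n)"
    using assms(2) by (auto simp: after_move_Some_iff)
  have "z - start y i = (x - start y i) + \<xi> (q, i, n)" using x by simp
  then have "l1_norm (z - start y i) \<le> l1_norm (x - start y i) + l1_norm (\<xi> (q, i, n))"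
    using l1_norm_triangle by metis
  also have "\<dots> \<le> int n + 1"
    using assms(1) assms(3)[OF x(1)] unfolding unit_speed_def by (intro add_mono) blast+
  finally show ?thesis by simp
qed

lemma frogs_distance:
  assumes "unit_speed \<xi>" "frogs y tie \<eta> \<xi> u n q = Some (z, i)"
  shows "l1_norm (z - start y i) \<le> int n"
  using assms(2)
proof (induction n arbitrary: q z i)
  case 0
  then show ?case by (auto simp: frogs_0 initial_config_def split: if_splits)
next
  case (Suc n)
  obtain tb where step: "frogs y tie \<eta> \<xi> u (Suc n) = activate y \<eta> tb (after_move y tie \<eta> \<xi> u n)"
    by (rule frogs_Suc)
  \<comment> \<open>A particle woken at this time stands where a moved particle of the same type
    stands, so the bound for moved particles covers it too.\<close>
  have "\<exists>q'. after_move y tie \<eta> \<xi> u n q' = Some (z, i)"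
  proof (cases "after_move y tie \<eta> \<xi> u n q")
    case None
    obtain x k where q: "q = (x, k)" by (cases q)
    have "z = x" "i \<in> types_at (after_move y tie \<eta> \<xi> u n) x"
      using activate_None[of "after_move y tie \<eta> \<xi> u n" x k y \<eta> tb z i] None Suc.prems step q by auto
    then show ?thesis by (auto simp: types_at_def)
  next
    case (Some s)
    then have "after_move y tie \<eta> \<xi> u n q = Some (z, i)"
      using Suc.prems step by (simp add: activate_Some)
    then show ?thesis by blast
  qed
  then show ?case using after_move_distance[OF assms(1)] Suc.IH by blast
qed

text \<open>When it is activated, the particle \<open>(x, k)\<close> stands at \<open>x\<close>, so
  \<open>frogs_distance\<close> at that time bounds the distance of \<open>x\<close> itself, and the
  bound only weakens later. Conversely, a site too far from both starts still has all its particles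
  dormant.\<close>

lemma origin_distance_of_active:
  assumes "unit_speed \<xi>" "frogs y tie \<eta> \<xi> u n (x, k) \<noteq> None" "x \<notin> {0, y}"
  shows "\<exists>i. l1_norm (x - start y i) \<le> int n"
  using assms(2)
proof (induction n)
  case 0
  then show ?case using assms(3) by (auto simp: frogs_0 initial_config_def split: if_splits)
next
  case (Suc n)
  obtain tb where step: "frogs y tie \<eta> \<xi> u (Suc n) = activate y \<eta> tb (after_move y tie \<eta> \<xi> u n)"
    by (rule frogs_Suc)
  obtain z i where z: "frogs y tie \<eta> \<xi> u (Suc n) (x, k) = Some (z, i)" using Suc.prems by auto
  show ?case
  proof (cases "after_move y tie \<eta> \<xi> u n (x, k)")
    case None
    have "z = x" using activate_None(1)[of "after_move y tie \<eta> \<xi> u n" x k y \<eta> tb z i] None z step by simp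
    then show ?thesis using frogs_distance[OF assms(1) z] by blast
  next
    case (Some s)
    then have "frogs y tie \<eta> \<xi> u n (x, k) \<noteq> None" by (auto simp: after_move_def move_def)
    from Suc.IH[OF this] obtain j where "l1_norm (x - start y j) \<le> int n" by blast
    then show ?thesis by (intro exI[of _ j]) simp
  qed
qed

lemma frog_type_cases: "j = i \<or> j = other_type i"
  by (cases i; cases j) auto

text \<open>
  At such a site no particle of the other type can be present at that time, and no particle at all
  can have been there before, because of the bound on the speed.
\<close>

lemma fastest_arrival_activates:
  assumes speed: "unit_speed \<xi>"
    and n: "l1_norm (z - start y i) = int (Suc n)"
    and far: "l1_norm (z - start y (other_type i)) > int (Suc n)"
    and q: "frogs y tie \<eta> \<xi> u (Suc n) q = Some (z, i)"
    and k: "k < \<eta> z"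
  shows "frogs y tie \<eta> \<xi> u (Suc n) (z, k) = Some (z, i)"
proof -
  obtain tb where step: "frogs y tie \<eta> \<xi> u (Suc n) = activate y \<eta> tb (after_move y tie \<eta> \<xi> u n)"
    by (rule frogs_Suc)
  have far': "l1_norm (z - start y j) > int n" for j
    using frog_type_cases[of j i] n far by auto
  then have z: "z \<notin> {0, y}"
    using far'[of Type1] far'[of Type2] by auto
  have types: "types_at (after_move y tie \<eta> \<xi> u n) z \<subseteq> {i}"
  proof
    fix j assume "j \<in> types_at (after_move y tie \<eta> \<xi> u n) z"
    then obtain q where "after_move y tie \<eta> \<xi> u n q = Some (z, j)" by (auto simp: types_at_def)
    then have "l1_norm (z - start y j) \<le> int (Suc n)"
      using after_move_distance[OF speed] frogs_distance[OF speed] by blast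
    with far frog_type_cases[of j i] show "j \<in> {i}" by auto
  qed
  have "types_at (after_move y tie \<eta> \<xi> u n) z \<noteq> {}"
  proof (cases "after_move y tie \<eta> \<xi> u n q")
    case None
    obtain x l where "q = (x, l)" by (cases q)
    then show ?thesis
      using activate_None[of "after_move y tie \<eta> \<xi> u n" x l y \<eta> tb z i] None q step by auto
  next
    case (Some s)
    then have "after_move y tie \<eta> \<xi> u n q = Some (z, i)" using q step by (simp add: activate_Some)
    then have "i \<in> types_at (after_move y tie \<eta> \<xi> u n) z" unfolding types_at_def by blast
    then show ?thesis by blast
  qed
  with types have types: "types_at (after_move y tie \<eta> \<xi> u n) z = {i}" by auto
  have "frogs y tie \<eta> \<xi> u n (z, k) = None"
    using origin_distance_of_active[OF speed, of y tie \<eta> u n z k] z far' by (meson not_le)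
  then have "after_move y tie \<eta> \<xi> u n (z, k) = None" by (simp add: after_move_def move_def)
  then show ?thesis using types z k step by (cases i) (auto simp: activate_def)
qed

text \<open>Types are kept forever, so at time \<open>n\<close> the \<open>n\<close> distinct
  particles \<open>w 0\<close>, ..., \<open>w (n - 1)\<close> all have type
  \<open>i\<close>.\<close>

lemma survives_if_infinitely_many_activated:
  assumes "\<And>n. \<exists>x. frogs y tie \<eta> \<xi> u (Suc n) (w n) = Some (x, i)" "inj w"
  shows "survives i (frogs y tie \<eta> \<xi> u)"
proof -
  have "n \<le> card (active_particles i (frogs y tie \<eta> \<xi> u n))" for n
  proof -
    have "w ` {..<n} \<subseteq> active_particles i (frogs y tie \<eta> \<xi> u n)"
    proof
      fix q assume "q \<in> w ` {..<n}"
      then obtain m where m: "q = w m" "Suc m \<le> n" by auto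
      obtain x where "frogs y tie \<eta> \<xi> u (Suc m) q = Some (x, i)" using assms(1) m(1) by blast
      from frogs_active_mono[OF this m(2)] show "q \<in> active_particles i (frogs y tie \<eta> \<xi> u n)"
        unfolding active_particles_def by blast
    qed
    then have "card (w ` {..<n}) \<le> card (active_particles i (frogs y tie \<eta> \<xi> u n))"
      by (intro card_mono finite_active_particles)
    moreover have "card (w ` {..<n}) = n"
      using card_image[OF inj_on_subset[OF assms(2) subset_UNIV]] by simp
    ultimately show ?thesis by simp
  qed
  then have "\<forall>\<^sub>F n in sequentially. n \<le> card (active_particles i (frogs y tie \<eta> \<xi> u n))"
    by (simp add: always_eventually)
  then show ?thesis
    unfolding survives_def by (rule filterlim_at_top_mono[OF filterlim_ident])
qed

section \<open>Quadrants\<close>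

datatype obstruction = Sparse | No_first | No_second

locale frog_cones =
  fixes y :: "('d::finite) site" and a b :: 'd
  assumes axes: "a \<noteq> b" and separated: "y $ a \<noteq> 0"
begin

definition offset :: "frog_type \<Rightarrow> 'd site" where
  "offset i = start y i - start y (other_type i)"

definition first_sign :: "frog_type \<Rightarrow> int" where
  "first_sign i = sgn (offset i $ a)"

text \<open>Unlike \<open>first_sign\<close> this must not vanish when the starts agree in
  coordinate \<open>b\<close>. In that case neither direction approaches the other start, and 1 is
  chosen.\<close>

definition second_sign :: "frog_type \<Rightarrow> int" where
  "second_sign i = (if offset i $ b \<ge> 0 then 1 else -1)"

definition first_dir :: "frog_type \<Rightarrow> 'd site" where
  "first_dir i = axis a (first_sign i)"

definition second_dir :: "frog_type \<Rightarrow> 'd site" where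
  "second_dir i = axis b (second_sign i)"

text \<open>
  A quadrant at \<open>start y i\<close>, shifted by one step so that it avoids the start, and directed away from
  the other start.
\<close>

definition cone :: "frog_type \<Rightarrow> int \<times> int \<Rightarrow> 'd site" where
  "cone i z = start y i + axis a (first_sign i * (fst z + 1)) + axis b (second_sign i * snd z)"

text \<open>In the quadrant this is the distance of the cone site from its start, hence the earliest
  time at which type \<open>i\<close> can be there; the summand 1 is the shift of the quadrant.
  Being positive, it keeps the displacements used at these sites apart from the first jumps at time
  0.\<close>

definition arrival :: "int \<times> int \<Rightarrow> nat" where
  "arrival z = nat (fst z + snd z + 1)"

lemma offset_first: "offset i $ a \<noteq> 0"
  using separated by (cases i) (auto simp: offset_def)

lemma first_sign_cases: "first_sign i = 1 \<or> first_sign i = -1"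
  using offset_first[of i] by (auto simp: first_sign_def sgn_if)

lemma second_sign_cases: "second_sign i = 1 \<or> second_sign i = -1"
  by (auto simp: second_sign_def)

lemma dirs_unit_vectors: "first_dir i \<in> unit_vectors" "second_dir i \<in> unit_vectors"
  using first_sign_cases[of i] second_sign_cases[of i]
  by (auto simp: first_dir_def second_dir_def unit_vectors_def)

lemma cone_origin: "cone i 0 = start y i + first_dir i"
  by (simp add: cone_def first_dir_def vec_eq_iff axis_def)

lemma cone_first: "cone i (z + (1, 0)) = cone i z + first_dir i"
  by (simp add: cone_def first_dir_def vec_eq_iff axis_def algebra_simps)

lemma cone_second: "cone i (z + (0, 1)) = cone i z + second_dir i"
  by (simp add: cone_def second_dir_def vec_eq_iff axis_def algebra_simps)

lemma cone_coordinates: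
  "cone i z $ a = start y i $ a + first_sign i * (fst z + 1)"
  "cone i z $ b = start y i $ b + second_sign i * snd z"
  using axes by (auto simp: cone_def axis_def)

lemma inj_cone: "inj (cone i)"
proof (rule injI)
  fix z z' assume "cone i z = cone i z'"
  then have "cone i z $ a = cone i z' $ a" "cone i z $ b = cone i z' $ b" by simp_all
  then have "first_sign i * (fst z + 1) = first_sign i * (fst z' + 1)"
    "second_sign i * snd z = second_sign i * snd z'"
    unfolding cone_coordinates by simp_all
  moreover have "first_sign i \<noteq> 0" "second_sign i \<noteq> 0"
    using first_sign_cases[of i] second_sign_cases[of i] by auto
  ultimately show "z = z'" by (simp add: prod_eq_iff)
qed

lemma cone_distance:
  assumes "0 \<le> fst z" "0 \<le> snd z"
  shows "l1_norm (cone i z - start y i) = int (arrival z)"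
proof (rule antisym)
  have "cone i z - start y i = axis a (first_sign i * (fst z + 1)) + axis b (second_sign i * snd z)"
    by (simp add: cone_def)
  also have "l1_norm \<dots> \<le> \<bar>first_sign i * (fst z + 1)\<bar> + \<bar>second_sign i * snd z\<bar>"
    using l1_norm_triangle l1_norm_axis by metis
  also have "\<dots> = int (arrival z)"
    using assms first_sign_cases[of i] second_sign_cases[of i] by (auto simp: arrival_def abs_mult)
  finally show "l1_norm (cone i z - start y i) \<le> int (arrival z)" .
  have "int (arrival z) = \<bar>(cone i z - start y i) $ a\<bar> + \<bar>(cone i z - start y i) $ b\<bar>"
    using assms first_sign_cases[of i] second_sign_cases[of i]
    by (auto simp: arrival_def abs_mult cone_coordinates)
  also have "\<dots> \<le> l1_norm (cone i z - start y i)"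
    by (rule l1_norm_ge_two_coordinates[OF axes])
  finally show "int (arrival z) \<le> l1_norm (cone i z - start y i)" .
qed

text \<open>In each of the two coordinates the steps of the cone have the sign of the offset between
  the starts, or that offset is 0, so absolute values add up. The offset in coordinate
  \<open>a\<close> is not 0, which makes the inequality strict and excludes ties.\<close>

lemma cone_distance_other:
  assumes "0 \<le> fst z" "0 \<le> snd z"
  shows "l1_norm (cone i z - start y (other_type i)) > int (arrival z)"
proof -
  let ?x = "cone i z - start y (other_type i)"
  have "?x $ a = offset i $ a + first_sign i * (fst z + 1)" "?x $ b = offset i $ b + second_sign i * snd z"
    by (simp_all add: cone_coordinates offset_def)
  then have "int (arrival z) < \<bar>?x $ a\<bar> + \<bar>?x $ b\<bar>"
    using assms offset_first[of i]
    by (auto simp: arrival_def first_sign_def second_sign_def sgn_if)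
  also have "\<dots> \<le> l1_norm ?x"
    by (rule l1_norm_ge_two_coordinates[OF axes])
  finally show ?thesis .
qed

text \<open>The jump obstructions refer to all names \<open>(cone i z, k)\<close> with
  \<open>k < M\<close>, whether or not the site holds that many particles. Thus
  \<open>Sparse\<close> is an event of the occupation numbers only, and the other two are events of
  the displacements only. A particle woken at time \<open>arrival z\<close> makes its first step
  with exactly that time index.\<close>

fun obstructed ::
    "nat \<Rightarrow> frog_type \<Rightarrow> ('d site \<Rightarrow> nat) \<Rightarrow> 'd displacements \<Rightarrow> obstruction \<Rightarrow> int \<times> int \<Rightarrow> bool"
where
  "obstructed M i \<eta> \<xi> Sparse z \<longleftrightarrow> \<eta> (cone i z) < M"
| "obstructed M i \<eta> \<xi> No_first z \<longleftrightarrow> (\<forall>k<M. \<xi> ((cone i z, k), i, arrival z) \<noteq> first_dir i)"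
| "obstructed M i \<eta> \<xi> No_second z \<longleftrightarrow> (\<forall>k<M. \<xi> ((cone i z, k), i, arrival z) \<noteq> second_dir i)"

definition closed_sites ::
    "nat \<Rightarrow> frog_type \<Rightarrow> ('d site \<Rightarrow> nat) \<Rightarrow> 'd displacements \<Rightarrow> (int \<times> int) set"
where
  "closed_sites M i \<eta> \<xi> = {z. 0 \<le> fst z \<and> 0 \<le> snd z \<and> (\<exists>r. obstructed M i \<eta> \<xi> r z)}"

text \<open>An open path is followed at full speed: type \<open>i\<close> is at
  \<open>cone i (w n)\<close> at time \<open>n + 1\<close> and wakes at least \<open>M\<close>
  particles there, and since the site is open, one of the first \<open>M\<close> makes the next step
  of the path at once.\<close>

lemma survives_if_no_dual_path:
  assumes speed: "unit_speed \<xi>"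
    and first: "\<xi> ((start y i, 0), i, 0) = first_dir i"
    and "south_east \<notin> dual_cluster (closed_sites M i \<eta> \<xi>)"
  shows "survives i (frogs y tie \<eta> \<xi> u)"
proof -
  obtain w where w: "w 0 = 0" "\<And>n. w n \<notin> closed_sites M i \<eta> \<xi>"
      "\<And>n. w (Suc n) - w n \<in> {(1, 0), (0, 1)}"
    using infinite_path_if_no_dual_path[OF assms(3)] by blast
  have step: "w (Suc n) = w n + (1, 0) \<or> w (Suc n) = w n + (0, 1)" for n
    using w(3)[of n] by (auto simp: algebra_simps prod_eq_iff)
  have nonneg: "0 \<le> fst (w n) \<and> 0 \<le> snd (w n) \<and> fst (w n) + snd (w n) = int n" for n
  proof (induction n)
    case (Suc n)
    then show ?case using step[of n] by auto
  qed (simp add: w(1))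
  have arrival: "arrival (w n) = Suc n" for n
    using nonneg[of n] by (auto simp: arrival_def)
  have open_site: "\<not> obstructed M i \<eta> \<xi> r (w n)" for r n
    using w(2)[of n] nonneg[of n] by (auto simp: closed_sites_def)
  have dense: "M \<le> \<eta> (cone i (w n))" for n
    using open_site[of Sparse n] by simp
  have activated: "frogs y tie \<eta> \<xi> u (Suc n) (cone i (w n), k) = Some (cone i (w n), i)"
    if "\<exists>q. frogs y tie \<eta> \<xi> u (Suc n) q = Some (cone i (w n), i)" "k < M" for n k
  proof -
    from that(1) obtain q where q: "frogs y tie \<eta> \<xi> u (Suc n) q = Some (cone i (w n), i)" ..
    show ?thesis
      by (rule fastest_arrival_activates[OF speed _ _ q])
         (use cone_distance[of "w n" i] cone_distance_other[of "w n" i] nonneg[of n] arrival[of n]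
           dense[of n] that(2) in simp_all)
  qed
  have reached: "\<exists>q. frogs y tie \<eta> \<xi> u (Suc n) q = Some (cone i (w n), i)" for n
  proof (induction n)
    case 0
    have "y \<noteq> 0" using separated by auto
    then have "frogs y tie \<eta> \<xi> u 0 (start y i, 0) = Some (start y i, i)"
      by (cases i) (auto simp: frogs_0 initial_config_def)
    from frogs_move[OF this] show ?case using first by (auto simp: w(1) cone_origin)
  next
    case (Suc n)
    have jump: "\<exists>q. frogs y tie \<eta> \<xi> u (Suc (Suc n)) q = Some (cone i (w n) + e, i)"
      if "k < M" "\<xi> ((cone i (w n), k), i, Suc n) = e" for k e
      using frogs_move[OF activated[OF Suc that(1)]] that(2) by blast
    show ?case
    proof (cases "w (Suc n) = w n + (1, 0)")
      case True
      obtain k where "k < M" "\<xi> ((cone i (w n), k), i, Suc n) = first_dir i"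
        using open_site[of No_first n] arrival[of n] by auto
      from jump[OF this] show ?thesis using True by (simp add: cone_first)
    next
      case False
      obtain k where "k < M" "\<xi> ((cone i (w n), k), i, Suc n) = second_dir i"
        using open_site[of No_second n] arrival[of n] by auto
      from jump[OF this] show ?thesis using False step[of n] by (simp add: cone_second)
    qed
  qed
  \<comment> \<open>For \<open>M = 0\<close> the condition \<open>No_first\<close> holds vacuously,
    so an open site forces \<open>M\<close> to be positive; particle 0 can then represent each site
    of the path.\<close>
  have "0 < M" using open_site[of No_first 0] by auto
  show ?thesis
  proof (rule survives_if_infinitely_many_activated)
    show "\<exists>x. frogs y tie \<eta> \<xi> u (Suc n) (cone i (w n), 0) = Some (x, i)" for n
      using activated[OF reached \<open>0 < M\<close>] by blast
    show "inj (\<lambda>n. (cone i (w n), 0::nat))"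
    proof (rule injI)
      fix m n assume "(cone i (w m), 0::nat) = (cone i (w n), 0)"
      then have "w m = w n" using inj_cone by (auto dest: injD)
      then show "m = n" using arrival by (metis Suc_inject)
    qed
  qed
qed

end

section \<open>Measurability\<close>

abbreviation occupation_algebra :: "(('d::finite) site \<Rightarrow> nat) measure" where
  "occupation_algebra \<equiv> PiM UNIV (\<lambda>_. count_space UNIV)"

abbreviation displacement_algebra :: "('d::finite) displacements measure" where
  "displacement_algebra \<equiv> PiM UNIV (\<lambda>_. count_space UNIV)"

abbreviation config_algebra :: "('d::finite) config measure" where
  "config_algebra \<equiv> PiM UNIV (\<lambda>_. count_space UNIV)"

instance frog_type :: countable
  by countable_datatype

lemma measurable_coordinate:
  assumes "f \<in> N \<rightarrow>\<^sub>M PiM UNIV (\<lambda>_. count_space UNIV)"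
  shows "(\<lambda>\<omega>. f \<omega> q) \<in> N \<rightarrow>\<^sub>M count_space UNIV"
  using measurable_compose[OF assms measurable_component_singleton[of q UNIV]] by simp

lemma measurable_into_PiM:
  assumes "\<And>q. (\<lambda>\<omega>. f \<omega> q) \<in> N \<rightarrow>\<^sub>M M"
  shows "f \<in> N \<rightarrow>\<^sub>M PiM UNIV (\<lambda>_. M)"
  using assms by (intro measurable_PiM_single') (auto simp: measurable_def space_PiM PiE_def extensional_def)

lemma pred_coordinate_eq:
  assumes "f \<in> N \<rightarrow>\<^sub>M PiM UNIV (\<lambda>_. count_space UNIV)"
  shows "Measurable.pred N (\<lambda>\<omega>. f \<omega> q = v)"
  by (rule measurable_compose[OF measurable_coordinate[OF assms, of q]]) simp

text \<open>Each entry of a configuration has countably many possible values, so the old entry may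
  be fixed; the new one then depends on a single displacement.\<close>

lemma measurable_move:
  fixes c :: "'w \<Rightarrow> ('d::finite) config"
  assumes c: "c \<in> N \<rightarrow>\<^sub>M config_algebra" and \<xi>: "\<xi> \<in> N \<rightarrow>\<^sub>M displacement_algebra"
  shows "(\<lambda>\<omega>. move (\<lambda>q i. \<xi> \<omega> (q, i, n)) (c \<omega>)) \<in> N \<rightarrow>\<^sub>M config_algebra"
proof (rule measurable_into_PiM)
  fix q :: "'d particle"
  have "(\<lambda>\<omega>. map_option (\<lambda>(z, i). (z + \<xi> \<omega> (q, i, n), i)) v) \<in> N \<rightarrow>\<^sub>M count_space UNIV"
    for v :: "('d site \<times> frog_type) option"
  proof (cases v)
    case (Some s)
    obtain z i where "s = (z, i)" by (cases s)
    then show ?thesis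
      using Some measurable_compose[OF measurable_coordinate[OF \<xi>, of "(q, i, n)"],
          of "\<lambda>d. Some (z + d, i)" "count_space UNIV"]
      by simp
  qed simp
  from measurable_compose_countable[OF this measurable_coordinate[OF c, of q]]
  show "(\<lambda>\<omega>. move (\<lambda>q i. \<xi> \<omega> (q, i, n)) (c \<omega>) q) \<in> N \<rightarrow>\<^sub>M count_space UNIV"
    by (simp add: move_def)
qed

lemma pred_types_at_eq:
  assumes "c \<in> N \<rightarrow>\<^sub>M config_algebra"
  shows "Measurable.pred N (\<lambda>\<omega>. types_at (c \<omega>) x = A)"
proof -
  have [measurable]: "Measurable.pred N (\<lambda>\<omega>. c \<omega> q = Some (x, i))" for q i
    by (rule pred_coordinate_eq[OF assms])
  have "Measurable.pred N (\<lambda>\<omega>. \<forall>i. (\<exists>q. c \<omega> q = Some (x, i)) = (i \<in> A))"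
    by measurable
  also have "(\<lambda>\<omega>. \<forall>i. (\<exists>q. c \<omega> q = Some (x, i)) = (i \<in> A)) = (\<lambda>\<omega>. types_at (c \<omega>) x = A)"
    by (auto simp: types_at_def fun_eq_iff)
  finally show ?thesis .
qed

lemma measurable_activate:
  fixes c :: "'w \<Rightarrow> ('d::finite) config"
  assumes c: "c \<in> N \<rightarrow>\<^sub>M config_algebra" and \<eta>: "\<eta> \<in> N \<rightarrow>\<^sub>M occupation_algebra"
    and tb: "\<And>x k. (\<lambda>\<omega>. tb \<omega> x k) \<in> N \<rightarrow>\<^sub>M count_space UNIV"
  shows "(\<lambda>\<omega>. activate y (\<eta> \<omega>) (tb \<omega>) (c \<omega>)) \<in> N \<rightarrow>\<^sub>M config_algebra"
proof (rule measurable_into_PiM)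
  fix q :: "'d particle"
  obtain x k where q: "q = (x, k)" by (cases q)
  have [measurable]: "Measurable.pred N (\<lambda>\<omega>. types_at (c \<omega>) x = A)" for A
    by (rule pred_types_at_eq[OF c])
  have [measurable]: "Measurable.pred N (\<lambda>\<omega>. k < \<eta> \<omega> x)"
    by (rule measurable_compose[OF measurable_coordinate[OF \<eta>, of x]]) simp
  have [measurable]: "(\<lambda>\<omega>. Some (x, tb \<omega> x k)) \<in> N \<rightarrow>\<^sub>M count_space UNIV"
    by (rule measurable_compose[OF tb]) simp
  define new where "new \<omega> = (if x \<notin> {0, y} \<and> k < \<eta> \<omega> x \<and> types_at (c \<omega>) x \<noteq> {}
      then if types_at (c \<omega>) x = {Type1} then Some (x, Type1)
        else if types_at (c \<omega>) x = {Type2} then Some (x, Type2) else Some (x, tb \<omega> x k)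
      else None)" for \<omega>
  have new: "new \<in> N \<rightarrow>\<^sub>M count_space UNIV"
    unfolding new_def by measurable
  have "(\<lambda>\<omega>. case v of Some s \<Rightarrow> Some s | None \<Rightarrow> new \<omega>) \<in> N \<rightarrow>\<^sub>M count_space UNIV" for v
    by (cases v) (use new in simp_all)
  from measurable_compose_countable[OF this measurable_coordinate[OF c, of q]]
  have "(\<lambda>\<omega>. case c \<omega> q of Some s \<Rightarrow> Some s | None \<Rightarrow> new \<omega>) \<in> N \<rightarrow>\<^sub>M count_space UNIV" .
  also have "(\<lambda>\<omega>. case c \<omega> q of Some s \<Rightarrow> Some s | None \<Rightarrow> new \<omega>)
      = (\<lambda>\<omega>. activate y (\<eta> \<omega>) (tb \<omega>) (c \<omega>) q)"
    unfolding q activate_def new_def prod.case by (intro ext option.case_cong refl if_cong) simp_all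
  finally show "(\<lambda>\<omega>. activate y (\<eta> \<omega>) (tb \<omega>) (c \<omega>) q) \<in> N \<rightarrow>\<^sub>M count_space UNIV" .
qed

text \<open>The induction carries the whole function of time rather than the current configuration,
  because the tie-breaking rule takes the history as an argument and its measurability is assumed
  jointly in \<open>\<eta>\<close>, history and \<open>u\<close>.\<close>

lemma measurable_history:
  fixes y :: "('d::finite) site"
  assumes "tie_breaking_mechanism R tie"
  shows "(\<lambda>(\<eta>, \<xi>, u). history y tie \<eta> \<xi> u n)
    \<in> occupation_algebra \<Otimes>\<^sub>M (displacement_algebra \<Otimes>\<^sub>M R) \<rightarrow>\<^sub>M PiM UNIV (\<lambda>_. config_algebra)"
proof -
  define N where "N = (occupation_algebra :: ('d site \<Rightarrow> nat) measure) \<Otimes>\<^sub>M ((displacement_algebra :: 'd displacements measure) \<Otimes>\<^sub>M R)"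
  have \<eta>: "fst \<in> N \<rightarrow>\<^sub>M occupation_algebra"
    and \<xi>: "(\<lambda>\<omega>. fst (snd \<omega>)) \<in> N \<rightarrow>\<^sub>M displacement_algebra"
    and u: "(\<lambda>\<omega>. snd (snd \<omega>)) \<in> N \<rightarrow>\<^sub>M R"
    unfolding N_def by measurable
  have "(\<lambda>\<omega>. history y tie (fst \<omega>) (fst (snd \<omega>)) (snd (snd \<omega>)) n) \<in> N \<rightarrow>\<^sub>M PiM UNIV (\<lambda>_. config_algebra)"
  proof (induction n)
    case 0
    show ?case
      unfolding history.simps by (rule measurable_into_PiM, rule measurable_into_PiM) simp
  next
    case (Suc n)
    define H where "H \<omega> = history y tie (fst \<omega>) (fst (snd \<omega>)) (snd (snd \<omega>)) n" for \<omega>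
    define c where "c \<omega> = move (\<lambda>q i. fst (snd \<omega>) (q, i, n)) (H \<omega> n)" for \<omega>
    have H: "H \<in> N \<rightarrow>\<^sub>M PiM UNIV (\<lambda>_. config_algebra)"
      using Suc by (simp add: H_def[abs_def])
    have Hm: "(\<lambda>\<omega>. H \<omega> m) \<in> N \<rightarrow>\<^sub>M config_algebra" for m
      using measurable_compose[OF H measurable_component_singleton[of m UNIV]] by simp
    have c: "c \<in> N \<rightarrow>\<^sub>M config_algebra"
      unfolding c_def[abs_def] by (rule measurable_move[OF Hm \<xi>])
    have upd: "(\<lambda>\<omega>. (H \<omega>)(Suc n := g \<omega>)) \<in> N \<rightarrow>\<^sub>M PiM UNIV (\<lambda>_. config_algebra)"
      if "g \<in> N \<rightarrow>\<^sub>M config_algebra" for g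
    proof (rule measurable_into_PiM)
      show "(\<lambda>\<omega>. ((H \<omega>)(Suc n := g \<omega>)) m) \<in> N \<rightarrow>\<^sub>M config_algebra" for m
        using Hm that by (cases "m = Suc n") auto
    qed
    have tie: "(\<lambda>\<omega>. tie (Suc n) (fst \<omega>) ((H \<omega>)(Suc n := c \<omega>)) (snd (snd \<omega>)) x k) \<in> N \<rightarrow>\<^sub>M count_space UNIV"
      for x k
    proof -
      have "(\<lambda>(\<eta>, h, u). tie (Suc n) \<eta> h u x k)
        \<in> occupation_algebra \<Otimes>\<^sub>M (PiM UNIV (\<lambda>_. config_algebra) \<Otimes>\<^sub>M R) \<rightarrow>\<^sub>M count_space UNIV"
        using assms by (simp add: tie_breaking_mechanism_def)
      from measurable_compose[OF measurable_Pair[OF \<eta> measurable_Pair[OF upd[OF c] u]] this]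
      show ?thesis by simp
    qed
    have "(\<lambda>\<omega>. activate y (fst \<omega>) (tie (Suc n) (fst \<omega>) ((H \<omega>)(Suc n := c \<omega>)) (snd (snd \<omega>))) (c \<omega>))
      \<in> N \<rightarrow>\<^sub>M config_algebra"
      by (rule measurable_activate[OF c \<eta> tie])
    from upd[OF this] show ?case
      by (simp only: history.simps Let_def c_def H_def)
  qed
  then show ?thesis by (simp add: N_def case_prod_beta')
qed

text \<open>This serves measurability: there are only countably many lists of particles, so a lower
  bound on the cardinality becomes a countable union of finite intersections of membership
  events.\<close>

lemma card_ge_iff_distinct_list:
  assumes "finite A"
  shows "K \<le> card A \<longleftrightarrow> (\<exists>qs. distinct qs \<and> length qs = K \<and> (\<forall>q\<in>set qs. q \<in> A))"
proof
  assume "K \<le> card A"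
  then obtain B where "B \<subseteq> A" "card B = K" "finite B" by (meson obtain_subset_with_card_n)
  then show "\<exists>qs. distinct qs \<and> length qs = K \<and> (\<forall>q\<in>set qs. q \<in> A)"
    by (metis distinct_card finite_distinct_list subsetD)
next
  assume "\<exists>qs. distinct qs \<and> length qs = K \<and> (\<forall>q\<in>set qs. q \<in> A)"
  then obtain qs where "distinct qs" "length qs = K" "set qs \<subseteq> A" by auto
  then show "K \<le> card A" using card_mono[OF assms] by (metis distinct_card)
qed

lemma pred_survives:
  fixes y :: "('d::finite) site"
  assumes "tie_breaking_mechanism R tie"
  shows "Measurable.pred (occupation_algebra \<Otimes>\<^sub>M (displacement_algebra \<Otimes>\<^sub>M R))
    (\<lambda>(\<eta>, \<xi>, u). survives i (frogs y tie \<eta> \<xi> u))"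
proof -
  define N where "N = (occupation_algebra :: ('d site \<Rightarrow> nat) measure) \<Otimes>\<^sub>M ((displacement_algebra :: 'd displacements measure) \<Otimes>\<^sub>M R)"
  define F where "F n = (\<lambda>(\<eta>, \<xi>, u). frogs y tie \<eta> \<xi> u n)" for n
  have F: "F n \<in> N \<rightarrow>\<^sub>M config_algebra" for n
    using measurable_compose[OF measurable_history[OF assms, of y n] measurable_component_singleton[of n UNIV]]
    by (simp add: F_def frogs_def N_def case_prod_beta')
  have [measurable]: "Measurable.pred N (\<lambda>\<omega>. q \<in> active_particles i (F n \<omega>))" for n q
    unfolding active_particles_def mem_Collect_eq
    by (intro pred_intros_countable pred_coordinate_eq[OF F])
  have [measurable]: "Measurable.pred N (\<lambda>\<omega>. K \<le> card (active_particles i (F n \<omega>)))" for K n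
  proof -
    have "Measurable.pred N (\<lambda>\<omega>. \<exists>qs. distinct qs \<and> length qs = K \<and>
        (\<forall>q\<in>set qs. q \<in> active_particles i (F n \<omega>)))"
      unfolding Ball_def by measurable
    also have "(\<lambda>\<omega>. \<exists>qs. distinct qs \<and> length qs = K \<and> (\<forall>q\<in>set qs. q \<in> active_particles i (F n \<omega>)))
      = (\<lambda>\<omega>. K \<le> card (active_particles i (F n \<omega>)))"
      by (rule ext, rule card_ge_iff_distinct_list[symmetric])
         (simp add: F_def case_prod_beta' finite_active_particles)
    finally show ?thesis .
  qed
  have "Measurable.pred N (\<lambda>\<omega>. \<forall>K. \<exists>n0. \<forall>n. n0 \<le> n \<longrightarrow> K \<le> card (active_particles i (F n \<omega>)))"
    by measurable
  also have "(\<lambda>\<omega>. \<forall>K. \<exists>n0. \<forall>n. n0 \<le> n \<longrightarrow> K \<le> card (active_particles i (F n \<omega>)))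
      = (\<lambda>(\<eta>, \<xi>, u). survives i (frogs y tie \<eta> \<xi> u))"
    by (auto simp: survives_def F_def filterlim_at_top eventually_sequentially fun_eq_iff)
  finally show ?thesis by (simp add: N_def)
qed

section \<open>The product space\<close>

lemma prob_cylinder:
  fixes K :: "'j \<Rightarrow> 'v pmf"
  assumes "finite J"
  shows "measure (PiM UNIV (\<lambda>j. measure_pmf (K j))) {f. \<forall>j\<in>J. f j \<in> B j} =
    (\<Prod>j\<in>J. measure_pmf.prob (K j) (B j))"
proof -
  interpret product_prob_space "\<lambda>j. measure_pmf (K j)" UNIV
    by (rule product_prob_spaceI) (rule prob_space_measure_pmf)
  have "prod_emb UNIV (\<lambda>j. measure_pmf (K j)) J (Pi\<^sub>E J B) = {f. \<forall>j\<in>J. f j \<in> B j}"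
    by (auto simp: prod_emb_def PiE_iff)
  with measure_PiM_emb[of J B] assms show ?thesis by simp
qed

lemma sets_PiM_measure_pmf:
  "sets (PiM UNIV (\<lambda>j. measure_pmf (K j))) = sets (PiM UNIV (\<lambda>_. count_space UNIV))"
  by (intro sets_PiM_cong) auto

lemma sets_cylinder:
  assumes "finite J"
  shows "{f. \<forall>j\<in>J. f j \<in> B j} \<in> sets (PiM UNIV (\<lambda>_. count_space UNIV))"
proof -
  have "prod_emb UNIV (\<lambda>_. count_space UNIV) J (Pi\<^sub>E J B) = {f. \<forall>j\<in>J. f j \<in> B j}"
    by (auto simp: prod_emb_def PiE_iff)
  with sets_PiM_I[of J UNIV B "\<lambda>_. count_space UNIV"] assms show ?thesis by simp
qed

lemma pmf_lazy_step_unit_vector: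
  fixes e :: "('d::finite) site"
  assumes "0 \<le> p" "p \<le> 1" "e \<in> unit_vectors"
  shows "pmf (lazy_step p) e = p / (2 * CARD('d))"
proof -
  have "e \<noteq> 0" using l1_norm_unit_vectors[OF assms(3)] by auto
  moreover have "(unit_vectors :: 'd site set) \<noteq> {}" using assms(3) by auto
  ultimately show ?thesis
    using assms
    by (simp add: lazy_step_def pmf_bind finite_unit_vectors card_unit_vectors indicator_def)
qed

lemma l1_norm_lazy_step:
  fixes e :: "('d::finite) site"
  assumes "e \<in> set_pmf (lazy_step p)"
  shows "l1_norm e \<le> 1"
proof -
  have ne: "(unit_vectors :: 'd site set) \<noteq> {}" by (simp add: unit_vectors_def)
  have "e \<in> insert 0 unit_vectors"
    using assms set_pmf_of_set[OF ne finite_unit_vectors] by (auto simp: lazy_step_def split: if_splits)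
  then show ?thesis using l1_norm_unit_vectors[of e] by auto
qed

definition jump_law :: "real \<Rightarrow> real \<Rightarrow> 'd particle \<times> frog_type \<times> nat \<Rightarrow> ('d::finite) site pmf" where
  "jump_law p1 p2 r = lazy_step (laziness p1 p2 (fst (snd r)))"

lemma displacement_law_eq: "displacement_law p1 p2 = PiM UNIV (\<lambda>r. measure_pmf (jump_law p1 p2 r))"
  by (simp add: displacement_law_def jump_law_def case_prod_beta')

lemma sets_displacement_law: "sets (displacement_law p1 p2) = sets displacement_algebra"
  unfolding displacement_law_eq by (rule sets_PiM_measure_pmf)

lemma prob_space_displacement_law: "prob_space (displacement_law p1 p2)"
  unfolding displacement_law_eq by (intro prob_space_PiM prob_space_measure_pmf)

lemma AE_unit_speed: "AE \<xi> in displacement_law p1 p2. unit_speed \<xi>"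
proof -
  have "AE \<xi> in displacement_law p1 p2. l1_norm (\<xi> r) \<le> 1" for r
    unfolding displacement_law_eq
    by (rule AE_PiM_component) (auto simp: prob_space_measure_pmf AE_measure_pmf_iff jump_law_def l1_norm_lazy_step)
  then show ?thesis unfolding unit_speed_def AE_all_countable by blast
qed

lemma sets_unit_speed: "{\<xi>. unit_speed \<xi>} \<in> sets displacement_algebra"
proof -
  have [measurable]: "Measurable.pred displacement_algebra (\<lambda>\<xi>. l1_norm (\<xi> r) \<le> 1)" for r
    by (rule measurable_compose[OF measurable_component_singleton[of r]]) auto
  have "Measurable.pred displacement_algebra (\<lambda>\<xi>. unit_speed \<xi>)"
    unfolding unit_speed_def by measurable
  then show ?thesis by (simp add: pred_def space_PiM)
qed

lemma measure_Times:
  assumes "prob_space M1" "prob_space M2" "A \<in> sets M1" "B \<in> sets M2"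
  shows "measure (M1 \<Otimes>\<^sub>M M2) (A \<times> B) = measure M1 A * measure M2 B"
proof -
  interpret M2: prob_space M2 by fact
  show ?thesis
    using M2.emeasure_pair_measure_Times[OF assms(3,4)] by (simp add: measure_def enn2real_mult)
qed

section \<open>The Peierls bound\<close>

text \<open>\<open>sparse_prob\<close> is the form in which both kinds of initial law enter:
  independent numbers give it as a product, a deterministic configuration gives it trivially. The
  constant 648 is 3 * 6^3: three obstructions per site, and then 6^(-3) per closed site, that is,
  less than 6^(-1) per step of a dual path that has three choices at each step.\<close>

locale frog_percolation = frog_cones y a b
  for y :: "('d::finite) site" and a b :: 'd +
  fixes p1 p2 :: real and R :: "real measure" and tie :: "'d tie_rule"
    and Q :: "('d site \<Rightarrow> nat) measure" and M :: nat
  assumes laziness_bounds: "0 < p1" "p1 \<le> 1" "0 < p2" "p2 \<le> 1"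
    and tie: "tie_breaking_mechanism R tie"
    and prob_Q: "prob_space Q" and sets_Q: "sets Q = sets occupation_algebra"
    and sparse_prob: "\<And>T. finite T \<Longrightarrow> T \<inter> {0, y} = {} \<Longrightarrow>
      measure Q {\<eta>. \<forall>x\<in>T. \<eta> x < M} \<le> (1 / 648) ^ card T"
    and no_jump_prob: "(1 - min p1 p2 / (2 * CARD('d))) ^ M \<le> 1 / 648"
begin

abbreviation \<Omega> where "\<Omega> \<equiv> frog_space p1 p2 R Q"

lemma prob_R: "prob_space R"
  using tie by (simp add: tie_breaking_mechanism_def)

lemma prob_\<Omega>: "prob_space \<Omega>"
  unfolding frog_space_def
  by (intro prob_space_pair prob_Q prob_R prob_space_displacement_law)

lemma sets_\<Omega>: "sets \<Omega> = sets (occupation_algebra \<Otimes>\<^sub>M (displacement_algebra \<Otimes>\<^sub>M R))"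
  unfolding frog_space_def by (intro sets_pair_measure_cong sets_Q sets_displacement_law refl)

lemma space_\<Omega>: "space \<Omega> = UNIV \<times> UNIV \<times> space R"
  using sets_eq_imp_space_eq[OF sets_\<Omega>] by (simp add: space_pair_measure space_PiM)

lemma rectangle:
  assumes "A \<in> sets occupation_algebra" "B \<in> sets displacement_algebra"
  shows "A \<times> B \<times> space R \<in> sets \<Omega>"
    and "measure \<Omega> (A \<times> B \<times> space R) = measure Q A * measure (displacement_law p1 p2) B"
proof -
  show "A \<times> B \<times> space R \<in> sets \<Omega>"
    unfolding sets_\<Omega> using assms by simp
  have B: "B \<in> sets (displacement_law p1 p2)" using assms(2) by (simp add: sets_displacement_law)
  have "measure \<Omega> (A \<times> B \<times> space R) = measure Q A * measure (displacement_law p1 p2 \<Otimes>\<^sub>M R) (B \<times> space R)"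
    unfolding frog_space_def
    using assms(1) B
    by (intro measure_Times prob_Q prob_space_pair prob_R prob_space_displacement_law) (simp_all add: sets_Q)
  also have "measure (displacement_law p1 p2 \<Otimes>\<^sub>M R) (B \<times> space R) = measure (displacement_law p1 p2) B"
    using measure_Times[OF prob_space_displacement_law prob_R B sets.top]
    by (simp add: prob_space.prob_space[OF prob_R])
  finally show "measure \<Omega> (A \<times> B \<times> space R) = measure Q A * measure (displacement_law p1 p2) B" .
qed

lemma prob_jump:
  fixes e :: "'d site"
  assumes "e \<in> unit_vectors"
  shows "measure_pmf.prob (jump_law p1 p2 (q, i, n)) {e} = laziness p1 p2 i / (2 * CARD('d))"
  using pmf_lazy_step_unit_vector[OF _ _ assms, of "laziness p1 p2 i"] laziness_bounds
  by (cases i) (simp_all add: jump_law_def laziness_def measure_pmf_single)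

lemma prob_no_jump:
  fixes e :: "'d site"
  assumes "e \<in> unit_vectors"
  shows "measure_pmf.prob (jump_law p1 p2 (q, i, n)) (- {e}) \<le> 1 - min p1 p2 / (2 * CARD('d))"
proof -
  have "measure_pmf.prob (jump_law p1 p2 (q, i, n)) (- {e}) =
      1 - measure_pmf.prob (jump_law p1 p2 (q, i, n)) {e}"
    using measure_pmf.prob_compl[of "{e}" "jump_law p1 p2 (q, i, n)"] by (simp add: Compl_eq_Diff_UNIV)
  moreover have "min p1 p2 / (2 * CARD('d)) \<le> laziness p1 p2 i / (2 * CARD('d))"
    by (intro divide_right_mono) (cases i, simp_all add: laziness_def)
  ultimately show ?thesis using prob_jump[OF assms, of q i n] by linarith
qed

section \<open>Cylinder events of first jumps and blocked jumps\<close>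

definition first_jumps :: "'d displacements \<Rightarrow> bool" where
  "first_jumps \<xi> \<longleftrightarrow> (\<forall>i\<in>{Type1, Type2}. \<xi> ((start y i, 0), i, 0) = first_dir i)"

definition first_jumps_prob :: real where
  "first_jumps_prob = (\<Prod>i\<in>{Type1, Type2}. laziness p1 p2 i / (2 * CARD('d)))"

lemma first_jumps_prob_pos: "0 < first_jumps_prob"
  using laziness_bounds by (simp add: first_jumps_prob_def laziness_def)

fun blocked_dir :: "frog_type \<Rightarrow> obstruction \<Rightarrow> 'd site" where
  "blocked_dir i No_second = second_dir i"
| "blocked_dir i _ = first_dir i"

lemma blocked_dir_unit_vector: "blocked_dir i r \<in> unit_vectors"
  using dirs_unit_vectors by (cases r) simp_all

definition blocked_jumps :: "frog_type \<Rightarrow> (int \<times> int \<Rightarrow> obstruction) \<Rightarrow> (int \<times> int) set \<Rightarrow> 'd displacements set"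
where
  "blocked_jumps i \<rho> S = {\<xi>. first_jumps \<xi> \<and>
     (\<forall>z\<in>S. \<forall>k<M. \<xi> ((cone i z, k), i, arrival z) \<noteq> blocked_dir i (\<rho> z))}"

lemma blocked_jumps:
  assumes "finite S" "\<And>z. z \<in> S \<Longrightarrow> 0 \<le> fst z \<and> 0 \<le> snd z"
  shows "blocked_jumps i \<rho> S \<in> sets displacement_algebra"
    and "measure (displacement_law p1 p2) (blocked_jumps i \<rho> S) \<le> first_jumps_prob * (1 / 648) ^ card S"
proof -
  define J1 where "J1 = (\<lambda>j. ((start y j, 0 :: nat), j, 0 :: nat)) ` {Type1, Type2}"
  define J2 where "J2 = (\<lambda>(z, k). ((cone i z, k), i, arrival z)) ` (S \<times> {..<M})"
  \<comment> \<open>The cylinder needs one constraint per index. Time index 0 marks the first jumps;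
    at later times the site label is traced back to \<open>z\<close> by injectivity of
    \<open>cone i\<close>.\<close>
  define B where "B r = (if snd (snd r) = 0 then {first_dir (fst (snd r))}
      else - {blocked_dir i (\<rho> (the_inv (cone i) (fst (fst r))))})"
    for r :: "'d particle \<times> frog_type \<times> nat"
  have arrival: "0 < arrival z" if "z \<in> S" for z
    using assms(2)[OF that] by (simp add: arrival_def)
  have fin: "finite J1" "finite J2" using assms(1) by (auto simp: J1_def J2_def)
  have disj: "J1 \<inter> J2 = {}"
  proof -
    have "snd (snd r) = 0" if "r \<in> J1" for r using that by (auto simp: J1_def)
    moreover have "snd (snd r) \<noteq> 0" if "r \<in> J2" for r
      using that by (auto simp: J2_def arrival)
    ultimately show ?thesis by blast
  qed
  have B2: "B ((cone i z, k), i, arrival z) = - {blocked_dir i (\<rho> z)}" if "z \<in> S" for z k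
    using arrival[OF that] by (simp add: B_def the_inv_f_f[OF inj_cone])
  have eq: "blocked_jumps i \<rho> S = {\<xi>. \<forall>r\<in>J1 \<union> J2. \<xi> r \<in> B r}"
  proof -
    have "first_jumps \<xi> \<longleftrightarrow> (\<forall>r\<in>J1. \<xi> r \<in> B r)" for \<xi>
      by (simp add: first_jumps_def J1_def B_def)
    moreover have "(\<forall>z\<in>S. \<forall>k<M. \<xi> ((cone i z, k), i, arrival z) \<noteq> blocked_dir i (\<rho> z))
        \<longleftrightarrow> (\<forall>r\<in>J2. \<xi> r \<in> B r)" for \<xi>
      by (auto simp: J2_def B2)
    ultimately show ?thesis by (auto simp: blocked_jumps_def)
  qed
  show "blocked_jumps i \<rho> S \<in> sets displacement_algebra"
    unfolding eq using fin by (intro sets_cylinder) simp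
  have "measure (displacement_law p1 p2) (blocked_jumps i \<rho> S)
      = (\<Prod>r\<in>J1 \<union> J2. measure_pmf.prob (jump_law p1 p2 r) (B r))"
    unfolding eq displacement_law_eq using fin by (intro prob_cylinder) simp
  also have "\<dots> = (\<Prod>r\<in>J1. measure_pmf.prob (jump_law p1 p2 r) (B r)) *
      (\<Prod>r\<in>J2. measure_pmf.prob (jump_law p1 p2 r) (B r))"
    by (rule prod.union_disjoint[OF fin disj])
  also have "(\<Prod>r\<in>J1. measure_pmf.prob (jump_law p1 p2 r) (B r)) = first_jumps_prob"
  proof -
    have "inj_on (\<lambda>j. ((start y j, 0 :: nat), j, 0 :: nat)) {Type1, Type2}"
      by (auto intro: inj_onI)
    then have "(\<Prod>r\<in>J1. measure_pmf.prob (jump_law p1 p2 r) (B r))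
      = (\<Prod>j\<in>{Type1, Type2}. measure_pmf.prob (jump_law p1 p2 ((start y j, 0), j, 0)) {first_dir j})"
      unfolding J1_def by (subst prod.reindex) (simp_all add: B_def)
    then show ?thesis by (simp only: prob_jump[OF dirs_unit_vectors(1)] first_jumps_prob_def)
  qed
  also have "(\<Prod>r\<in>J2. measure_pmf.prob (jump_law p1 p2 r) (B r)) \<le> (1 / 648) ^ card S"
  proof -
    let ?\<beta> = "1 - min p1 p2 / (2 * CARD('d))"
    have inj: "inj_on (\<lambda>(z, k). ((cone i z, k), i, arrival z)) (S \<times> {..<M})"
      using inj_cone by (auto intro!: inj_onI dest: injD)
    have "(\<Prod>r\<in>J2. measure_pmf.prob (jump_law p1 p2 r) (B r)) \<le> (\<Prod>r\<in>J2. ?\<beta>)"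
    proof (rule prod_mono, intro conjI)
      fix r assume "r \<in> J2"
      then obtain z k where z: "z \<in> S" "r = ((cone i z, k), i, arrival z)" by (auto simp: J2_def)
      then show "measure_pmf.prob (jump_law p1 p2 r) (B r) \<le> ?\<beta>"
        using prob_no_jump[OF blocked_dir_unit_vector] by (simp add: B2)
    qed simp
    also have "\<dots> = (?\<beta> ^ M) ^ card S"
      unfolding J2_def prod_constant card_image[OF inj]
      by (simp add: card_cartesian_product power_mult[symmetric] mult.commute)
    also have "\<dots> \<le> (1 / 648) ^ card S"
    proof (rule power_mono[OF no_jump_prob])
      have "measure_pmf.prob (jump_law p1 p2 ((0, 0), i, 0)) (- {first_dir i}) \<le> ?\<beta>"
        by (rule prob_no_jump[OF dirs_unit_vectors(1)])
      then have "0 \<le> ?\<beta>" using measure_nonneg order_trans by blast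
      then show "0 \<le> ?\<beta> ^ M" by simp
    qed
    finally show ?thesis .
  qed
  finally show "measure (displacement_law p1 p2) (blocked_jumps i \<rho> S) \<le> first_jumps_prob * (1 / 648) ^ card S"
    using first_jumps_prob_pos by simp
qed

text \<open>The first jumps of both types are part of the event, so that every bound carries the
  factor \<open>first_jumps_prob\<close> and can be compared with the probability of the first
  jumps, however small that is.\<close>

definition all_closed :: "frog_type \<Rightarrow> (int \<times> int) set \<Rightarrow> (('d site \<Rightarrow> nat) \<times> 'd displacements \<times> real) set" where
  "all_closed i S = {(\<eta>, \<xi>, u). u \<in> space R \<and> first_jumps \<xi> \<and> S \<subseteq> closed_sites M i \<eta> \<xi>}"

lemma cone_avoids_starts:
  assumes "0 \<le> fst z" "0 \<le> snd z"
  shows "cone i z \<notin> {0, y}"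
proof -
  have "cone i z \<noteq> start y j" for j
    using frog_type_cases[of j i] cone_distance[OF assms, of i] cone_distance_other[OF assms, of i] assms
    by (auto simp: arrival_def)
  from this[of Type1] this[of Type2] show ?thesis by simp
qed

text \<open>\<open>No_first\<close> and \<open>No_second\<close> at one site look at the same
  displacements and are not independent. Therefore \<open>\<rho>\<close> selects a single
  obstruction for each site; for a fixed selection the bounds multiply, with 1/648 per site, and the
  3 selections per site turn this into 1/216.\<close>

lemma all_closed_bound:
  assumes "finite S"
  shows "all_closed i S \<in> sets \<Omega>" and "measure \<Omega> (all_closed i S) \<le> first_jumps_prob * (1 / 216) ^ card S"
proof -
  interpret \<Omega>: prob_space \<Omega> by (rule prob_\<Omega>)
  have "all_closed i S \<in> sets \<Omega> \<and> measure \<Omega> (all_closed i S) \<le> first_jumps_prob * (1 / 216) ^ card S"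
  proof (cases "\<forall>z\<in>S. 0 \<le> fst z \<and> 0 \<le> snd z")
    case False
    then have "all_closed i S = {}" by (auto simp: all_closed_def closed_sites_def)
    then show ?thesis using first_jumps_prob_pos by simp
  next
    case True
    define A where "A \<rho> = {\<eta>. \<forall>x\<in>cone i ` {z \<in> S. \<rho> z = Sparse}. \<eta> x < M}" for \<rho> :: "int \<times> int \<Rightarrow> obstruction"
    define E where "E \<rho> = A \<rho> \<times> blocked_jumps i \<rho> {z \<in> S. \<rho> z \<noteq> Sparse} \<times> space R" for \<rho>
    have obstructions: "UNIV = {Sparse, No_first, No_second}" using obstruction.exhaust by auto
    have "finite (UNIV :: obstruction set)" and card3: "card (UNIV :: obstruction set) = 3"
      unfolding obstructions by simp_all
    then have fin: "finite (S \<rightarrow>\<^sub>E (UNIV :: obstruction set))"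
      and card: "card (S \<rightarrow>\<^sub>E (UNIV :: obstruction set)) = 3 ^ card S"
      using assms by (auto intro: finite_PiE simp: card_PiE card3)
    have obs: "obstructed M i \<eta> \<xi> r z \<longleftrightarrow> (if r = Sparse then \<eta> (cone i z) < M
        else \<forall>k<M. \<xi> ((cone i z, k), i, arrival z) \<noteq> blocked_dir i r)" for \<eta> \<xi> r z
      by (cases r) auto
    have E_iff: "(\<eta>, \<xi>, u) \<in> E \<rho> \<longleftrightarrow> u \<in> space R \<and> first_jumps \<xi> \<and> (\<forall>z\<in>S. obstructed M i \<eta> \<xi> (\<rho> z) z)"
      for \<eta> \<xi> u \<rho>
      unfolding obs by (auto simp: E_def A_def blocked_jumps_def)
    have union: "all_closed i S = (\<Union>\<rho>\<in>S \<rightarrow>\<^sub>E UNIV. E \<rho>)"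
    proof (intro equalityI subsetI)
      fix \<omega> assume \<omega>: "\<omega> \<in> all_closed i S"
      obtain \<eta> \<xi> u where eq: "\<omega> = (\<eta>, \<xi>, u)" by (cases \<omega>)
      have "\<forall>z\<in>S. \<exists>r. obstructed M i \<eta> \<xi> r z"
        using \<omega> by (auto simp: eq all_closed_def closed_sites_def)
      then obtain \<rho> where \<rho>: "\<forall>z\<in>S. obstructed M i \<eta> \<xi> (\<rho> z) z" by metis
      have "\<omega> \<in> E (restrict \<rho> S)"
        using \<omega> \<rho> unfolding eq E_iff by (simp add: all_closed_def)
      then show "\<omega> \<in> (\<Union>\<rho>\<in>S \<rightarrow>\<^sub>E UNIV. E \<rho>)" by (intro UN_I[of "restrict \<rho> S"]) auto
    next
      fix \<omega> assume "\<omega> \<in> (\<Union>\<rho>\<in>S \<rightarrow>\<^sub>E UNIV. E \<rho>)"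
      then obtain \<rho> where \<rho>: "\<omega> \<in> E \<rho>" by blast
      obtain \<eta> \<xi> u where eq: "\<omega> = (\<eta>, \<xi>, u)" by (cases \<omega>)
      from \<rho> True show "\<omega> \<in> all_closed i S"
        unfolding eq E_iff by (auto simp: all_closed_def closed_sites_def)
    qed
    have E: "E \<rho> \<in> sets \<Omega>" "measure \<Omega> (E \<rho>) \<le> first_jumps_prob * (1 / 648) ^ card S" for \<rho>
    proof -
      let ?T = "{z \<in> S. \<rho> z = Sparse}" and ?U = "{z \<in> S. \<rho> z \<noteq> Sparse}"
      have A: "A \<rho> \<in> sets occupation_algebra"
        unfolding A_def using sets_cylinder[of "cone i ` ?T" "\<lambda>_. {..<M}"] assms by simp
      have bj: "blocked_jumps i \<rho> ?U \<in> sets displacement_algebra"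
        "measure (displacement_law p1 p2) (blocked_jumps i \<rho> ?U) \<le> first_jumps_prob * (1 / 648) ^ card ?U"
        using assms True by (auto intro!: blocked_jumps)
      show "E \<rho> \<in> sets \<Omega>" unfolding E_def by (rule rectangle(1)[OF A bj(1)])
      have "measure Q (A \<rho>) \<le> (1 / 648) ^ card (cone i ` ?T)"
        unfolding A_def
      proof (rule sparse_prob)
        have "cone i z \<notin> {0, y}" if "z \<in> S" for z using that True cone_avoids_starts by blast
        then show "cone i ` ?T \<inter> {0, y} = {}" by blast
      qed (use assms in simp)
      also have "card (cone i ` ?T) = card ?T"
        by (rule card_image[OF inj_on_subset[OF inj_cone subset_UNIV]])
      finally have "measure Q (A \<rho>) \<le> (1 / 648) ^ card ?T" .
      then have "measure \<Omega> (E \<rho>) \<le> (1 / 648) ^ card ?T * (first_jumps_prob * (1 / 648) ^ card ?U)"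
        unfolding E_def rectangle(2)[OF A bj(1)] using bj(2) by (intro mult_mono) auto
      also have "\<dots> = first_jumps_prob * (1 / 648) ^ (card ?T + card ?U)"
        by (simp only: power_add mult_ac)
      also have "card ?T + card ?U = card (?T \<union> ?U)"
        using assms by (intro card_Un_disjoint[symmetric]) auto
      also have "?T \<union> ?U = S" by auto
      finally show "measure \<Omega> (E \<rho>) \<le> first_jumps_prob * (1 / 648) ^ card S" .
    qed
    have "measure \<Omega> (all_closed i S) \<le> (\<Sum>\<rho>\<in>S \<rightarrow>\<^sub>E UNIV. measure \<Omega> (E \<rho>))"
      unfolding union using E(1) by (intro \<Omega>.finite_measure_subadditive_finite fin) auto
    also have "\<dots> \<le> (\<Sum>\<rho>\<in>S \<rightarrow>\<^sub>E (UNIV :: obstruction set). first_jumps_prob * (1 / 648) ^ card S)"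
      by (intro sum_mono E(2))
    also have "\<dots> = first_jumps_prob * (3 ^ card S * (1 / 648) ^ card S)"
      by (simp add: card)
    also have "3 ^ card S * (1 / 648) ^ card S = (1 / 216 :: real) ^ card S"
      by (simp add: power_mult_distrib[symmetric])
    finally have "measure \<Omega> (all_closed i S) \<le> first_jumps_prob * (1 / 216) ^ card S" .
    moreover have "all_closed i S \<in> sets \<Omega>"
      unfolding union using E(1) fin by (intro sets.finite_UN) auto
    ultimately show ?thesis by blast
  qed
  then show "all_closed i S \<in> sets \<Omega>" "measure \<Omega> (all_closed i S) \<le> first_jumps_prob * (1 / 216) ^ card S"
    by blast+
qed

section \<open>Summation over dual paths\<close>

definition blocked :: "frog_type \<Rightarrow> (('d site \<Rightarrow> nat) \<times> 'd displacements \<times> real) set" where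
  "blocked i = {(\<eta>, \<xi>, u). u \<in> space R \<and> first_jumps \<xi> \<and>
     south_east \<in> dual_cluster (closed_sites M i \<eta> \<xi>)}"

text \<open>A dual path to \<open>south_east\<close> with \<open>n\<close> steps crosses (n + 2) / 3
  closed sites. As 216 = 6^3, it costs at most 6^(-(n + 2)), against at most 3^n such paths; the
  series has ratio 1/2 and sum 2/36 = 1/18.\<close>

lemma blocked_bound: "blocked i \<in> sets \<Omega>" "measure \<Omega> (blocked i) \<le> first_jumps_prob / 18"
proof -
  interpret \<Omega>: prob_space \<Omega> by (rule prob_\<Omega>)
  define P where "P n = {zs. dual_path zs \<and> distinct zs \<and> hd zs = south_east \<and> length zs = Suc n}" for n
  define E where "E n = (\<Union>zs\<in>P n. all_closed i (crossed zs))" for n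
  have sub: "P n \<subseteq> {zs. dual_path zs \<and> length zs = Suc n}" for n by (auto simp: P_def)
  have P: "finite (P n)" "card (P n) \<le> 3 ^ n" for n
    using dual_paths_finite_card[of n] finite_subset[OF sub] card_mono[OF _ sub] order_trans by blast+
  have union: "blocked i = (\<Union>n. E n)"
  proof (intro equalityI subsetI)
    fix \<omega> assume \<omega>: "\<omega> \<in> blocked i"
    obtain \<eta> \<xi> u where eq: "\<omega> = (\<eta>, \<xi>, u)" by (cases \<omega>)
    from \<omega> obtain zs where zs: "dual_path (south_east # zs)" "distinct (south_east # zs)"
        "crossed (south_east # zs) \<subseteq> closed_sites M i \<eta> \<xi>"
      unfolding eq blocked_def dual_cluster_def by blast
    then have "south_east # zs \<in> P (length zs)" by (simp add: P_def)
    moreover have "\<omega> \<in> all_closed i (crossed (south_east # zs))"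
      using \<omega> zs(3) by (simp add: eq all_closed_def blocked_def)
    ultimately show "\<omega> \<in> (\<Union>n. E n)" unfolding E_def by blast
  next
    fix \<omega> assume "\<omega> \<in> (\<Union>n. E n)"
    then obtain n zs where zs: "zs \<in> P n" "\<omega> \<in> all_closed i (crossed zs)" unfolding E_def by blast
    obtain \<eta> \<xi> u where eq: "\<omega> = (\<eta>, \<xi>, u)" by (cases \<omega>)
    obtain xs where xs: "zs = south_east # xs" using zs(1) by (cases zs) (auto simp: P_def)
    have "south_east \<in> dual_cluster (closed_sites M i \<eta> \<xi>)"
      unfolding dual_cluster_def mem_Collect_eq
      using zs by (intro exI[of _ xs]) (simp add: P_def xs eq all_closed_def)
    then show "\<omega> \<in> blocked i"
      using zs(2) by (simp add: eq all_closed_def blocked_def)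
  qed
  have E_sets: "E n \<in> sets \<Omega>" for n
    unfolding E_def using all_closed_bound(1)[OF finite_crossed] P(1) by (intro sets.finite_UN) auto
  show "blocked i \<in> sets \<Omega>"
    unfolding union using E_sets by (intro sets.countable_UN) auto
  have path: "measure \<Omega> (all_closed i (crossed zs)) \<le> first_jumps_prob * (1 / 6) ^ (n + 2)" if zs: "zs \<in> P n" for zs n
  proof -
    obtain xs where xs: "zs = south_east # xs" "length xs = n" using zs by (cases zs) (auto simp: P_def)
    have "3 * int (card (crossed zs)) = int n + fst south_east - snd south_east"
      using card_crossed[of south_east xs] zs xs by (auto simp: P_def)
    then have "3 * card (crossed zs) = n + 2" by (simp add: south_east_def)
    moreover have "(1 / 216 :: real) ^ card (crossed zs) = (1 / 6) ^ (3 * card (crossed zs))"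
      by (simp add: power_mult power3_eq_cube)
    ultimately show ?thesis using all_closed_bound(2)[OF finite_crossed, of i zs] by (simp only:)
  qed
  have E_bound: "measure \<Omega> (E n) \<le> first_jumps_prob / 36 * (1 / 2) ^ n" for n
  proof -
    have "measure \<Omega> (E n) \<le> (\<Sum>zs\<in>P n. measure \<Omega> (all_closed i (crossed zs)))"
      unfolding E_def using all_closed_bound(1)[OF finite_crossed]
      by (intro \<Omega>.finite_measure_subadditive_finite P) auto
    also have "\<dots> \<le> (\<Sum>zs\<in>P n. first_jumps_prob * (1 / 6) ^ (n + 2))"
      by (intro sum_mono path)
    also have "\<dots> = real (card (P n)) * (first_jumps_prob * (1 / 6) ^ (n + 2))"
      by simp
    also have "\<dots> \<le> 3 ^ n * (first_jumps_prob * (1 / 6) ^ (n + 2))"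
    proof (intro mult_right_mono)
      have "real (card (P n)) \<le> real (3 ^ n)" using P(2) by (rule of_nat_mono)
      then show "real (card (P n)) \<le> 3 ^ n" by simp
    qed (use first_jumps_prob_pos in simp)
    also have "\<dots> = first_jumps_prob / 36 * (3 ^ n * (1 / 6) ^ n)"
      by (simp add: power_add power2_eq_square)
    also have "3 ^ n * (1 / 6) ^ n = (1 / 2 :: real) ^ n"
      by (simp add: power_mult_distrib[symmetric])
    finally show ?thesis .
  qed
  have geometric: "(\<lambda>n. first_jumps_prob / 36 * (1 / 2) ^ n) sums (first_jumps_prob / 36 * 2)"
    using geometric_sums[of "1 / 2 :: real"] by (intro sums_mult) simp
  have summable: "summable (\<lambda>n. measure \<Omega> (E n))"
    using E_bound by (intro summable_comparison_test'[OF sums_summable[OF geometric], of 0]) simp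
  have "measure \<Omega> (blocked i) \<le> (\<Sum>n. measure \<Omega> (E n))"
    unfolding union using E_sets summable by (intro \<Omega>.finite_measure_subadditive_countably) auto
  also have "\<dots> \<le> (\<Sum>n. first_jumps_prob / 36 * (1 / 2) ^ n)"
    by (rule suminf_le[OF E_bound summable sums_summable[OF geometric]])
  also have "\<dots> = first_jumps_prob / 18"
    using sums_unique[OF geometric] by simp
  finally show "measure \<Omega> (blocked i) \<le> first_jumps_prob / 18" .
qed

text \<open>Given the first jumps and unit speed, coexistence can fail only if one of the types is
  blocked. The union bound leaves at least 1 - 2/18 = 8/9 of \<open>first_jumps_prob\<close>,
  whatever the dependence between the two blocked events.\<close>

lemma coexistence_prob_pos: "0 < coexistence_prob p1 p2 y R tie Q"
proof -
  interpret \<Omega>: prob_space \<Omega> by (rule prob_\<Omega>)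
  define C where "C = {\<omega> \<in> space \<Omega>. case \<omega> of (\<eta>, \<xi>, u) \<Rightarrow>
      survives Type1 (frogs y tie \<eta> \<xi> u) \<and> survives Type2 (frogs y tie \<eta> \<xi> u)}"
  have "Measurable.pred \<Omega> (\<lambda>\<omega>. case \<omega> of (\<eta>, \<xi>, u) \<Rightarrow> survives i (frogs y tie \<eta> \<xi> u))" for i
    using pred_survives[OF tie, of i y] measurable_cong_sets[OF sets_\<Omega> refl] by blast
  from pred_intros_logic(3)[OF this[of Type1] this[of Type2]]
  have "Measurable.pred \<Omega> (\<lambda>\<omega>. case \<omega> of (\<eta>, \<xi>, u) \<Rightarrow>
      survives Type1 (frogs y tie \<eta> \<xi> u) \<and> survives Type2 (frogs y tie \<eta> \<xi> u))"
    by (simp add: case_prod_beta')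
  then have C: "C \<in> sets \<Omega>" unfolding C_def by (simp add: pred_def)
  \<comment> \<open>The space contains all displacement functions, so \<open>unit_speed\<close>
    holds only almost surely; intersecting with it does not change the probability.\<close>
  define B where "B = {\<xi>. first_jumps \<xi> \<and> unit_speed \<xi>}"
  define J where "J = (\<lambda>j. ((start y j, 0 :: nat), j, 0 :: nat)) ` {Type1, Type2}"
  have cyl: "{\<xi>. first_jumps \<xi>} = {\<xi>. \<forall>r\<in>J. \<xi> r \<in> {first_dir (fst (snd r))}}"
    by (simp add: first_jumps_def J_def)
  have first_sets: "{\<xi>. first_jumps \<xi>} \<in> sets displacement_algebra"
    unfolding cyl by (rule sets_cylinder) (simp add: J_def)
  have B: "B \<in> sets displacement_algebra"
    using sets.Int[OF first_sets sets_unit_speed] by (simp add: B_def Collect_conj_eq)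
  have "measure (displacement_law p1 p2) B = measure (displacement_law p1 p2) {\<xi>. first_jumps \<xi>}"
  proof (rule finite_measure.finite_measure_eq_AE)
    show "finite_measure (displacement_law p1 p2)"
      by (rule prob_space.finite_measure[OF prob_space_displacement_law])
    show "AE \<xi> in displacement_law p1 p2. \<xi> \<in> B \<longleftrightarrow> \<xi> \<in> {\<xi>. first_jumps \<xi>}"
      using AE_unit_speed by eventually_elim (simp add: B_def)
  qed (use B first_sets in \<open>simp_all add: sets_displacement_law\<close>)
  also have "\<dots> = (\<Prod>r\<in>J. measure_pmf.prob (jump_law p1 p2 r) {first_dir (fst (snd r))})"
    unfolding cyl displacement_law_eq by (rule prob_cylinder) (simp add: J_def)
  also have "\<dots> = (\<Prod>j\<in>{Type1, Type2}. measure_pmf.prob (jump_law p1 p2 ((start y j, 0), j, 0)) {first_dir j})"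
    unfolding J_def by (subst prod.reindex) (auto intro: inj_onI)
  also have "\<dots> = first_jumps_prob"
    by (simp only: prob_jump[OF dirs_unit_vectors(1)] first_jumps_prob_def)
  finally have prob_B: "measure (displacement_law p1 p2) B = first_jumps_prob" .
  have UQ: "UNIV \<in> sets occupation_algebra"
    using sets.top[of occupation_algebra] by (simp add: space_PiM)
  have "measure Q UNIV = 1"
    using prob_space.prob_space[OF prob_Q] sets_eq_imp_space_eq[OF sets_Q] by (simp add: space_PiM)
  then have "first_jumps_prob = measure \<Omega> (UNIV \<times> B \<times> space R)"
    using rectangle(2)[OF UQ B] prob_B by simp
  also have "\<dots> \<le> measure \<Omega> (C \<union> (blocked Type1 \<union> blocked Type2))"
  proof (rule \<Omega>.finite_measure_mono)
    show "UNIV \<times> B \<times> space R \<subseteq> C \<union> (blocked Type1 \<union> blocked Type2)"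
    proof
      fix \<omega> :: "('d site \<Rightarrow> nat) \<times> 'd displacements \<times> real"
      assume "\<omega> \<in> UNIV \<times> B \<times> space R"
      then obtain \<eta> \<xi> u where \<omega>: "\<omega> = (\<eta>, \<xi>, u)" "first_jumps \<xi>" "unit_speed \<xi>" "u \<in> space R"
        by (auto simp: B_def)
      have "survives i (frogs y tie \<eta> \<xi> u)" if "\<omega> \<notin> blocked i" for i
      proof (rule survives_if_no_dual_path[OF \<omega>(3)])
        show "\<xi> ((start y i, 0), i, 0) = first_dir i"
          using \<omega>(2) by (cases i) (simp_all add: first_jumps_def)
        show "south_east \<notin> dual_cluster (closed_sites M i \<eta> \<xi>)"
          using that \<omega> by (simp add: blocked_def)
      qed
      then show "\<omega> \<in> C \<union> (blocked Type1 \<union> blocked Type2)"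
        using \<omega> by (auto simp: C_def space_\<Omega>)
    qed
  qed (use C blocked_bound(1) in auto)
  also have "\<dots> \<le> measure \<Omega> C + measure \<Omega> (blocked Type1 \<union> blocked Type2)"
    by (intro measure_Un_le C sets.Un blocked_bound(1))
  also have "\<dots> \<le> measure \<Omega> C + (measure \<Omega> (blocked Type1) + measure \<Omega> (blocked Type2))"
    by (intro add_left_mono measure_Un_le blocked_bound(1))
  also have "\<dots> \<le> measure \<Omega> C + (first_jumps_prob / 18 + first_jumps_prob / 18)"
    by (intro add_mono blocked_bound(2) order_refl)
  finally have "0 < measure \<Omega> C" using first_jumps_prob_pos by simp
  then show ?thesis by (simp add: coexistence_prob_def C_def case_prod_beta')
qed

end

section \<open>The two kinds of initial law and the choice of \<open>M\<close>\<close>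

lemma deterministic_law_sparse_prob:
  assumes "finite T" "T \<inter> {0, y} = {}" "\<And>x. x \<notin> {0, y} \<Longrightarrow> M \<le> \<eta> x" "0 \<le> (\<delta> :: real)"
  shows "measure (deterministic_law \<eta>) {\<eta>'. \<forall>x\<in>T. \<eta>' x < M} \<le> \<delta> ^ card T"
proof -
  have "{\<eta>'. \<forall>x\<in>T. \<eta>' x < M} \<in> sets occupation_algebra"
    using sets_cylinder[OF assms(1), of "\<lambda>_. {..<M}"] by simp
  then have eq: "measure (deterministic_law \<eta>) {\<eta>'. \<forall>x\<in>T. \<eta>' x < M} = indicator {\<eta>'. \<forall>x\<in>T. \<eta>' x < M} \<eta>"
    unfolding deterministic_law_def by (rule measure_return)
  show ?thesis
  \<comment> \<open>For empty \<open>T\<close> both sides are 1; for nonempty \<open>T\<close> the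
    event has probability 0.\<close>
  proof (cases "T = {}")
    case True
    show ?thesis unfolding eq by (simp add: True)
  next
    case False
    then obtain x where "x \<in> T" by blast
    then have "M \<le> \<eta> x" using assms(2,3) by blast
    with \<open>x \<in> T\<close> show ?thesis unfolding eq using assms(4) by (auto simp: indicator_def)
  qed
qed

lemma iid_law_sparse_prob:
  assumes "finite T" "1 - \<delta> \<le> measure_pmf.prob \<mu> {k. M \<le> k}"
  shows "measure (iid_law \<mu>) {\<eta>. \<forall>x\<in>T. \<eta> x < M} \<le> \<delta> ^ card T"
proof -
  have "{..<M} = UNIV - {k. M \<le> k}" by auto
  then have "measure_pmf.prob \<mu> {..<M} = 1 - measure_pmf.prob \<mu> {k. M \<le> k}"
    using measure_pmf.prob_compl[of "{k. M \<le> k}" \<mu>] by simp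
  then have "measure_pmf.prob \<mu> {..<M} \<le> \<delta>" using assms(2) by simp
  moreover have "measure (iid_law \<mu>) {\<eta>. \<forall>x\<in>T. \<eta> x < M} = measure_pmf.prob \<mu> {..<M} ^ card T"
    using prob_cylinder[OF assms(1), of "\<lambda>_. \<mu>" "\<lambda>_. {..<M}"] by (simp add: iid_law_def)
  ultimately show ?thesis by (simp add: power_mono)
qed

lemma prob_space_deterministic_law: "prob_space (deterministic_law \<eta>)"
  unfolding deterministic_law_def by (rule prob_space_return) (simp add: space_PiM)

lemma sets_deterministic_law: "sets (deterministic_law \<eta>) = sets occupation_algebra"
  by (simp add: deterministic_law_def)

lemma prob_space_iid_law: "prob_space (iid_law \<mu>)"
  unfolding iid_law_def by (intro prob_space_PiM prob_space_measure_pmf)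

lemma sets_iid_law: "sets (iid_law \<mu>) = sets occupation_algebra"
  unfolding iid_law_def by (rule sets_PiM_measure_pmf)

theorem proposition3p2:
  assumes "CARD('d::finite) \<ge> 2"
  shows "\<exists>(M :: real \<Rightarrow> nat) (\<theta> :: nat \<Rightarrow> real).
    (\<forall>m. 0 < \<theta> m \<and> \<theta> m < 1) \<and>
    (\<forall>(p1::real) (p2::real) (y :: 'd site) (R :: real measure) (tie :: 'd tie_rule).
      0 < p1 \<longrightarrow> p1 \<le> 1 \<longrightarrow> 0 < p2 \<longrightarrow> p2 \<le> 1 \<longrightarrow> y \<noteq> 0 \<longrightarrow> tie_breaking_mechanism R tie \<longrightarrow>
        (\<forall>\<eta> :: 'd site \<Rightarrow> nat.
          (\<forall>x. x \<notin> {0, y} \<longrightarrow> \<eta> x \<ge> M (min p1 p2)) \<longrightarrow>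
          coexistence_prob p1 p2 y R tie (deterministic_law \<eta>) > 0) \<and>
        (\<forall>\<mu> :: nat pmf.
          measure_pmf.prob \<mu> {k. k \<ge> M (min p1 p2)} \<ge> \<theta> (M (min p1 p2)) \<longrightarrow>
          coexistence_prob p1 p2 y R tie (iid_law \<mu>) > 0))"
proof -
  \<comment> \<open>The bounds on \<open>p\<close> stand inside the existential so that
    \<open>M\<close> can be chosen as a function on all reals. The choice sees only \<open>p\<close>
    and the dimension.\<close>
  have "\<exists>m. 0 < p \<longrightarrow> p \<le> 1 \<longrightarrow> (1 - p / (2 * CARD('d))) ^ m \<le> 1 / 648" for p :: real
  proof (cases "0 < p \<and> p \<le> 1")
    case True
    then have "1 - p / (2 * CARD('d)) < 1" by simp
    then obtain m where "(1 - p / (2 * CARD('d))) ^ m < 1 / 648"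
      using real_arch_pow_inv[of "1 / 648" "1 - p / (2 * CARD('d))"] by force
    then show ?thesis by (intro exI[of _ m]) simp
  qed blast
  then obtain M :: "real \<Rightarrow> nat" where
    M: "0 < p \<Longrightarrow> p \<le> 1 \<Longrightarrow> (1 - p / (2 * CARD('d))) ^ M p \<le> 1 / 648" for p
    by metis
  have pos: "0 < coexistence_prob p1 p2 y R tie Q"
    if "0 < p1" "p1 \<le> 1" "0 < p2" "p2 \<le> 1" "y \<noteq> 0" "tie_breaking_mechanism R tie"
      "prob_space Q" "sets Q = sets occupation_algebra"
      "\<And>T. finite T \<Longrightarrow> T \<inter> {0, y} = {} \<Longrightarrow>
        measure Q {\<eta>. \<forall>x\<in>T. \<eta> x < M (min p1 p2)} \<le> (1 / 648) ^ card T"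
    for p1 p2 R Q and y :: "'d site" and tie :: "'d tie_rule"
  proof -
    \<comment> \<open>The first axis must separate the starts; the second one is where dimension at
      least 2 enters, since oriented paths need two directions.\<close>
    obtain a where a: "y $ a \<noteq> 0" using \<open>y \<noteq> 0\<close> by (auto simp: vec_eq_iff)
    have "\<exists>b. a \<noteq> b"
    proof (rule ccontr)
      assume "\<not> (\<exists>b. a \<noteq> b)"
      then have "UNIV = {a}" by auto
      then have "CARD('d) = card {a}" by (rule arg_cong)
      with assms show False by simp
    qed
    then obtain b where "a \<noteq> b" ..
    interpret prob_space Q by fact
    have "(1 - min p1 p2 / (2 * CARD('d))) ^ M (min p1 p2) \<le> 1 / 648"
      using that by (intro M) auto
    then interpret frog_percolation y a b p1 p2 R tie Q "M (min p1 p2)"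
      using that a \<open>a \<noteq> b\<close> by unfold_locales
    show ?thesis by (rule coexistence_prob_pos)
  qed
  show ?thesis
  \<comment> \<open>With 1 - 1/648 a site is sparse with probability at most 1/648, the bound also
    imposed on the jump obstructions. It serves for every \<open>M\<close>, so \<theta> is
    constant.\<close>
  proof (rule exI[of _ M], rule exI[of _ "\<lambda>_. 1 - 1 / 648"], intro conjI allI impI)
    fix p1 p2 :: real and y :: "'d site" and R and tie :: "'d tie_rule" and \<eta> :: "'d site \<Rightarrow> nat"
    assume *: "0 < p1" "p1 \<le> 1" "0 < p2" "p2 \<le> 1" "y \<noteq> 0" "tie_breaking_mechanism R tie"
    assume "\<forall>x. x \<notin> {0, y} \<longrightarrow> M (min p1 p2) \<le> \<eta> x"
    then have "measure (deterministic_law \<eta>) {\<eta>'. \<forall>x\<in>T. \<eta>' x < M (min p1 p2)} \<le> (1 / 648) ^ card T"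
      if "finite T" "T \<inter> {0, y} = {}" for T
      using that by (intro deterministic_law_sparse_prob[of T y]) simp_all
    then show "0 < coexistence_prob p1 p2 y R tie (deterministic_law \<eta>)"
      by (rule pos[OF * prob_space_deterministic_law sets_deterministic_law])
  next
    fix p1 p2 :: real and y :: "'d site" and R and tie :: "'d tie_rule" and \<mu> :: "nat pmf"
    assume *: "0 < p1" "p1 \<le> 1" "0 < p2" "p2 \<le> 1" "y \<noteq> 0" "tie_breaking_mechanism R tie"
    assume "1 - 1 / 648 \<le> measure_pmf.prob \<mu> {k. M (min p1 p2) \<le> k}"
    then have "measure (iid_law \<mu>) {\<eta> :: 'd site \<Rightarrow> nat. \<forall>x\<in>T. \<eta> x < M (min p1 p2)} \<le> (1 / 648) ^ card T"
      if "finite T" for T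
      using that by (intro iid_law_sparse_prob)
    then show "0 < coexistence_prob p1 p2 y R tie (iid_law \<mu>)"
      by (intro pos[OF * prob_space_iid_law sets_iid_law])
  qed simp_all
qed

end
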